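(* Let $P$ be a $2$-nearly simple convex polytope. Then the face lattice of $P$ can be determined from the graph of $P$.
   Context: All polytopes are convex polytopes. The (edge-vertex) graph $G_P$ of a polytope $P$ has as vertices the vertices of $P$, with two vertices adjacent iff some $1$-dimensional face of $P$ contains both. A $d$-dimensional polytope $P$ is $h$-nearly simple if $\deg_{G_P}(v)=d$ for all but exactly $h$ vertices $v$ of $P$. "The face lattice can be determined from the graph" means that the face lattice of $P$ (up to isomorphism) is determined by the abstract graph $G_P$: any $2$-nearly simple polytope whose graph is isomorphic to $G_P$ has face lattice isomorphic to that of $P$. *)

theory Defs
  imports "HOL-Analysis.Analysis"
begin

definition poly_vertices :: "'a::euclidean_space set \<Rightarrow> 'a set" where
  "poly_vertices P = {v. {v} face_of P}"

definition poly_adj :: "'a::euclidean_space set \<Rightarrow> 'a \<Rightarrow> 'a \<Rightarrow> bool" where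
  "poly_adj P u v \<longleftrightarrow> u \<in> poly_vertices P \<and> v \<in> poly_vertices P \<and> u \<noteq> v \<and>
     (\<exists>E. E face_of P \<and> aff_dim E = 1 \<and> u \<in> E \<and> v \<in> E)"

definition poly_degree :: "'a::euclidean_space set \<Rightarrow> 'a \<Rightarrow> nat" where
  "poly_degree P v = card {u. poly_adj P v u}"

definition nearly_simple :: "nat \<Rightarrow> 'a::euclidean_space set \<Rightarrow> bool" where
  "nearly_simple h P \<longleftrightarrow> polytope P \<and>
     card {v \<in> poly_vertices P. int (poly_degree P v) \<noteq> aff_dim P} = h"

definition graph_iso :: "'a::euclidean_space set \<Rightarrow> 'b::euclidean_space set \<Rightarrow> bool" where
  "graph_iso P Q \<longleftrightarrow> (\<exists>f. bij_betw f (poly_vertices P) (poly_vertices Q) \<and>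
     (\<forall>u\<in>poly_vertices P. \<forall>v\<in>poly_vertices P. poly_adj P u v \<longleftrightarrow> poly_adj Q (f u) (f v)))"

text \<open>Isomorphism of face lattices (all faces, including the empty face and the polytope itself), ordered by inclusion.\<close>
definition face_lattice_iso :: "'a::euclidean_space set \<Rightarrow> 'b::euclidean_space set \<Rightarrow> bool" where
  "face_lattice_iso P Q \<longleftrightarrow> (\<exists>g. bij_betw g {F. F face_of P} {G. G face_of Q} \<and>
     (\<forall>F1. F1 face_of P \<longrightarrow> (\<forall>F2. F2 face_of P \<longrightarrow> (F1 \<subseteq> F2 \<longleftrightarrow> g F1 \<subseteq> g F2))))"

end

theory Submission
  imports Defs
begin

text \<open>
  Call a height function on the vertices good if every nonempty face has exactly one local sink. At a vertex \<open>v\<close>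
  of degree \<open>dim P\<close> the faces with local sink \<open>v\<close> correspond to the sets of lower neighbours, so, as in Kalai's
  proof for simple polytopes, \<open>\<Sum> 2 ^ indeg v\<close> over these vertices is at least the number of faces minus the number
  of faces having one of the two exceptional vertices \<open>x\<close>, \<open>y\<close> as a local sink, with equality for the good
  heights. A good height of \<open>P\<close> is therefore good for \<open>Q\<close> as soon as these two numbers are controlled, and then the
  faces of \<open>P\<close> that are initial segments are faces of \<open>Q\<close>, being spanned at their sinks.
  Three stages suffice. If \<open>x\<close> is the minimum and \<open>y\<close> the maximum, all faces through \<open>y\<close> and no other faces (except
  \<open>{x}\<close>) are lost; this settles the faces through exactly one of \<open>x\<close>, \<open>y\<close>. If \<open>x\<close> is the minimum and \<open>y\<close> is
  not the sink of a face through \<open>x\<close>, nothing unknown is lost in \<open>P\<close>; choosing between two such heights with disjoint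
  sets of lower neighbours of \<open>y\<close> gives the same for \<open>Q\<close>, which settles the faces through both. After that every
  good height of \<open>P\<close> is good for \<open>Q\<close>. The heights needed are quotients of affine functionals: these allow \<open>x\<close> and
  \<open>y\<close> to be separated in ways that a linear functional need not admit.
\<close>

section \<open>Face systems with two exceptional vertices\<close>

lemma inj_on_less:
  fixes h :: "'v \<Rightarrow> real"
  assumes "inj_on h V" "u \<in> V" "v \<in> V" "u \<noteq> v" "h u \<le> h v"
  shows "h u < h v"
proof -
  have "h u \<noteq> h v" using inj_onD[OF assms(1) _ assms(2,3)] assms(4) by auto
  then show ?thesis using assms(5) by simp
qed

lemma finite_maximizer:
  fixes h :: "'v \<Rightarrow> real"
  assumes "finite F" "F \<noteq> {}"
  obtains m where "m \<in> F" "\<And>u. u \<in> F \<Longrightarrow> h u \<le> h m"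
proof -
  have "Max (h ` F) \<in> h ` F" using assms by (intro Max_in) auto
  then obtain m where "m \<in> F" "h m = Max (h ` F)" by auto
  then show thesis using that[of m] assms by simp
qed

text \<open>Edges are oriented towards the larger value of \<open>h\<close>; these are then the
  local maxima of \<open>h\<close> in the graph induced on \<open>F\<close>.\<close>

definition sinks :: "('v \<Rightarrow> 'v \<Rightarrow> bool) \<Rightarrow> ('v \<Rightarrow> real) \<Rightarrow> 'v set \<Rightarrow> 'v set" where
  "sinks adj h F = {v \<in> F. \<forall>u\<in>F. adj v u \<longrightarrow> h u < h v}"

definition unique_sinks :: "('v \<Rightarrow> 'v \<Rightarrow> bool) \<Rightarrow> 'v set set \<Rightarrow> ('v \<Rightarrow> real) \<Rightarrow> bool" where
  "unique_sinks adj \<F> h \<longleftrightarrow> (\<forall>F\<in>\<F>. card (sinks adj h F) = 1)"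

definition initial :: "'v set \<Rightarrow> ('v \<Rightarrow> real) \<Rightarrow> 'v set \<Rightarrow> bool" where
  "initial V h F \<longleftrightarrow> (\<forall>v\<in>F. \<forall>u\<in>V. h u < h v \<longrightarrow> u \<in> F)"

definition height :: "'v set \<Rightarrow> ('v \<Rightarrow> 'v \<Rightarrow> bool) \<Rightarrow> 'v set set \<Rightarrow> ('v \<Rightarrow> real) \<Rightarrow> bool" where
  "height V adj \<F> h \<longleftrightarrow> inj_on h V \<and> unique_sinks adj \<F> h"

text \<open>This abstracts the nonempty faces of a polytope, given by their vertex sets, with
  \<open>x\<close> and \<open>y\<close> as the vertices that may fail to be simple. By
  \<open>nbr_sub\<close>, inclusion of faces can be tested on the edges at any common vertex;
  \<open>span_face\<close> and \<open>deg_face\<close> express simplicity away from \<open>x\<close>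
  and \<open>y\<close>; the four height assumptions carry the remaining geometry. Everything up to
  \<open>face_systems_eq\<close> is then combinatorial.\<close>

locale face_system =
  fixes V :: "'v set" and adj :: "'v \<Rightarrow> 'v \<Rightarrow> bool" and x y :: 'v and \<F> :: "'v set set"
  assumes finite_V: "finite V"
    and adjD: "adj u v \<Longrightarrow> u \<in> V \<and> v \<in> V \<and> u \<noteq> v"
    and adj_sym: "adj u v \<Longrightarrow> adj v u"
    and xy: "x \<in> V" "y \<in> V" "x \<noteq> y"
    and face_ne: "F \<in> \<F> \<Longrightarrow> F \<noteq> {}"
    and face_sub: "F \<in> \<F> \<Longrightarrow> F \<subseteq> V"
    and top_face: "V \<in> \<F>"
    and vertex_face: "v \<in> V \<Longrightarrow> {v} \<in> \<F>"
    and edge_face: "adj u v \<Longrightarrow> {u, v} \<in> \<F>"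
    and Int_face: "F \<in> \<F> \<Longrightarrow> G \<in> \<F> \<Longrightarrow> F \<inter> G \<noteq> {} \<Longrightarrow> F \<inter> G \<in> \<F>"
    and nbr_sub: "F \<in> \<F> \<Longrightarrow> G \<in> \<F> \<Longrightarrow> v \<in> F \<Longrightarrow> v \<in> G \<Longrightarrow> F \<inter> Collect (adj v) \<subseteq> G \<Longrightarrow> F \<subseteq> G"
    and span_face: "v \<in> V - {x, y} \<Longrightarrow> S \<subseteq> Collect (adj v) \<Longrightarrow> \<exists>F\<in>\<F>. v \<in> F \<and> F \<inter> Collect (adj v) = S"
    and deg_face: "F \<in> \<F> \<Longrightarrow> v \<in> F - {x, y} \<Longrightarrow> w \<in> F - {x, y} \<Longrightarrow>
        card (F \<inter> Collect (adj v)) = card (F \<inter> Collect (adj w))"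
    and height_initial: "F \<in> \<F> \<Longrightarrow> \<exists>h. height V adj \<F> h \<and> initial V h F"
    and height_separating: "F \<in> \<F> \<Longrightarrow> s \<in> F \<Longrightarrow> t \<in> V - F \<Longrightarrow>
        \<exists>h. height V adj \<F> h \<and> initial V h F \<and> (\<forall>v\<in>V-{s}. h s < h v) \<and> (\<forall>v\<in>V-{t}. h v < h t)"
    and height_adjacent: "F \<in> \<F> \<Longrightarrow> x \<in> F \<Longrightarrow> y \<in> F \<Longrightarrow> adj x y \<Longrightarrow>
        \<exists>h. height V adj \<F> h \<and> initial V h F \<and> (\<forall>v\<in>V-{x}. h x < h v) \<and>
          (\<forall>v\<in>V. h v < h y \<longrightarrow> v = x)"
    and height_nonadjacent: "F \<in> \<F> \<Longrightarrow> x \<in> F \<Longrightarrow> y \<in> F \<Longrightarrow> \<not> adj x y \<Longrightarrow>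
        \<exists>h1 h2. (\<forall>h\<in>{h1, h2}. height V adj \<F> h \<and> initial V h F \<and> (\<forall>v\<in>V-{x}. h x < h v) \<and>
            (\<forall>G\<in>\<F>. x \<in> G \<longrightarrow> y \<notin> sinks adj h G)) \<and>
          (\<forall>u. adj y u \<longrightarrow> \<not> (h1 u < h1 y \<and> h2 u < h2 y))"
begin

lemma finite_F: "finite \<F>"
  using finite_subset[of \<F> "Pow V"] finite_V face_sub by auto

lemma finite_face: "F \<in> \<F> \<Longrightarrow> finite F"
  using face_sub finite_V finite_subset by blast

lemma maximizer_sink:
  assumes "inj_on h V" "F \<in> \<F>"
  obtains m where "m \<in> sinks adj h F" "\<And>u. u \<in> F \<Longrightarrow> h u \<le> h m"
proof -
  obtain m where m: "m \<in> F" "\<And>u. u \<in> F \<Longrightarrow> h u \<le> h m"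
    using finite_maximizer[OF finite_face[OF assms(2)] face_ne[OF assms(2)], of h] by metis
  have "h u < h m" if "u \<in> F" "adj m u" for u
    using m(2)[OF that(1)] adjD[OF that(2)] by (intro inj_on_less[OF assms(1)]) auto
  then have "m \<in> sinks adj h F" using m(1) by (auto simp: sinks_def)
  then show thesis using m(2) that by blast
qed

lemma sinks_nonempty: "inj_on h V \<Longrightarrow> F \<in> \<F> \<Longrightarrow> sinks adj h F \<noteq> {}"
  using maximizer_sink by blast

section \<open>Double counting of faces and their sinks\<close>

definition sink_count :: "('v \<Rightarrow> real) \<Rightarrow> 'v \<Rightarrow> nat" where
  "sink_count h v = card {F \<in> \<F>. v \<in> sinks adj h F}"

text \<open>Sending a face through \<open>v\<close> to its set of neighbours of \<open>v\<close> is
  injective by \<open>nbr_sub\<close> and reaches every set of neighbours by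
  \<open>span_face\<close>; having \<open>v\<close> as a sink means that this set consists of lower
  neighbours.\<close>

lemma sink_count_simple:
  assumes v: "v \<in> V - {x, y}"
  shows "sink_count h v = 2 ^ card {u. adj v u \<and> h u < h v}"
proof -
  let ?N = "{u. adj v u \<and> h u < h v}"
  have fin: "finite ?N" by (rule finite_subset[OF _ finite_V]) (auto dest: adjD)
  have "bij_betw (\<lambda>F. F \<inter> Collect (adj v)) {F \<in> \<F>. v \<in> sinks adj h F} (Pow ?N)"
  proof (rule bij_betw_imageI)
    show "inj_on (\<lambda>F. F \<inter> Collect (adj v)) {F \<in> \<F>. v \<in> sinks adj h F}"
    proof (rule inj_onI)
      fix F G assume F: "F \<in> {F \<in> \<F>. v \<in> sinks adj h F}" and G: "G \<in> {F \<in> \<F>. v \<in> sinks adj h F}"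
        and eq: "F \<inter> Collect (adj v) = G \<inter> Collect (adj v)"
      have m: "F \<in> \<F>" "G \<in> \<F>" "v \<in> F" "v \<in> G" using F G by (simp_all add: sinks_def)
      have "F \<inter> Collect (adj v) \<subseteq> G" "G \<inter> Collect (adj v) \<subseteq> F" using eq by blast+
      then show "F = G" using nbr_sub[OF m] nbr_sub[OF m(2,1,4,3)] by (rule_tac equalityI)
    qed
    show "(\<lambda>F. F \<inter> Collect (adj v)) ` {F \<in> \<F>. v \<in> sinks adj h F} = Pow ?N"
    proof
      show "(\<lambda>F. F \<inter> Collect (adj v)) ` {F \<in> \<F>. v \<in> sinks adj h F} \<subseteq> Pow ?N"
        by (auto simp: sinks_def)
      show "Pow ?N \<subseteq> (\<lambda>F. F \<inter> Collect (adj v)) ` {F \<in> \<F>. v \<in> sinks adj h F}"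
      proof
        fix S assume S: "S \<in> Pow ?N"
        then have "S \<subseteq> Collect (adj v)" by auto
        from span_face[OF v this] obtain F where F: "F \<in> \<F>" "v \<in> F" "F \<inter> Collect (adj v) = S" by blast
        have "h u < h v" if "u \<in> F" "adj v u" for u using that F(3) S by blast
        then have "v \<in> sinks adj h F" using F(2) by (simp add: sinks_def)
        then show "S \<in> (\<lambda>F. F \<inter> Collect (adj v)) ` {F \<in> \<F>. v \<in> sinks adj h F}" using F by blast
      qed
    qed
  qed
  from bij_betw_same_card[OF this] show ?thesis by (simp add: sink_count_def card_Pow[OF fin])
qed

text \<open>Pairs of a face and one of its sinks are counted in two ways. Apart from the sink counts
  at \<open>x\<close> and \<open>y\<close>, the right-hand side depends only on the graph and on
  \<open>h\<close>.\<close>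

lemma sum_card_sinks:
  "(\<Sum>F\<in>\<F>. card (sinks adj h F)) =
     (\<Sum>v\<in>V-{x,y}. 2 ^ card {u. adj v u \<and> h u < h v}) + sink_count h x + sink_count h y"
proof -
  have "(\<Sum>F\<in>\<F>. card (sinks adj h F)) = (\<Sum>F\<in>\<F>. \<Sum>v\<in>V. if v \<in> sinks adj h F then 1 else 0)"
  proof (rule sum.cong[OF refl])
    fix F assume "F \<in> \<F>"
    then have "sinks adj h F \<subseteq> V" using face_sub by (auto simp: sinks_def)
    then have "V \<inter> {v. v \<in> sinks adj h F} = sinks adj h F" by auto
    then show "card (sinks adj h F) = (\<Sum>v\<in>V. if v \<in> sinks adj h F then 1 else 0)"
      using finite_V by (simp add: sum.If_cases)
  qed
  also have "\<dots> = (\<Sum>v\<in>V. \<Sum>F\<in>\<F>. if v \<in> sinks adj h F then 1 else 0)" by (rule sum.swap)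
  also have "\<dots> = (\<Sum>v\<in>V. sink_count h v)"
    by (rule sum.cong[OF refl]) (simp add: sink_count_def sum.If_cases finite_F Int_def)
  also have "\<dots> = (\<Sum>v\<in>V-{x,y}. sink_count h v) + sink_count h x + sink_count h y"
  proof -
    have "V = insert x (insert y (V - {x,y}))" using xy by auto
    then have "(\<Sum>v\<in>V. sink_count h v) = (\<Sum>v\<in>insert x (insert y (V - {x,y})). sink_count h v)" by simp
    then show ?thesis using xy finite_V by simp
  qed
  also have "(\<Sum>v\<in>V-{x,y}. sink_count h v) = (\<Sum>v\<in>V-{x,y}. 2 ^ card {u. adj v u \<and> h u < h v})"
    by (rule sum.cong[OF refl]) (rule sink_count_simple)
  finally show ?thesis .
qed

text \<open>The maximum of an injective \<open>h\<close> on a face is a sink, so every summand is at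
  least 1, and the excess of the sum over \<open>card \<F>\<close> measures the failure of
  \<open>unique_sinks\<close>.\<close>

lemma card_le_sum_sinks:
  assumes "inj_on h V" shows "card \<F> \<le> (\<Sum>F\<in>\<F>. card (sinks adj h F))"
    and "(\<Sum>F\<in>\<F>. card (sinks adj h F)) \<le> card \<F> \<longleftrightarrow> unique_sinks adj \<F> h"
proof -
  have one: "1 \<le> card (sinks adj h F)" if "F \<in> \<F>" for F
  proof -
    have "finite (sinks adj h F)" using finite_face[OF that] by (simp add: sinks_def)
    then show ?thesis using sinks_nonempty[OF assms that] by (simp add: Suc_le_eq card_gt_0_iff)
  qed
  show le: "card \<F> \<le> (\<Sum>F\<in>\<F>. card (sinks adj h F))"
    using sum_mono[of \<F> "\<lambda>_. 1" "\<lambda>F. card (sinks adj h F)"] one by simp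
  show "(\<Sum>F\<in>\<F>. card (sinks adj h F)) \<le> card \<F> \<longleftrightarrow> unique_sinks adj \<F> h" (is "?l \<longleftrightarrow> ?r")
  proof
    assume ?r then show ?l by (simp add: unique_sinks_def)
  next
    assume ?l
    then have eq: "(\<Sum>F\<in>\<F>. 1) = (\<Sum>F\<in>\<F>. card (sinks adj h F))" using le by simp
    show ?r unfolding unique_sinks_def
    proof
      fix F assume "F \<in> \<F>"
      then show "card (sinks adj h F) = 1"
        using sum_mono_inv[OF eq one, of F] finite_F by simp
    qed
  qed
qed

lemma sink_maximizer:
  assumes h: "height V adj \<F> h" "F \<in> \<F>" and v: "v \<in> sinks adj h F" "u \<in> F"
  shows "h u \<le> h v"
proof -
  have inj: "inj_on h V" and c: "card (sinks adj h F) = 1" using h by (auto simp: height_def unique_sinks_def)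
  obtain m where m: "m \<in> sinks adj h F" "\<And>u. u \<in> F \<Longrightarrow> h u \<le> h m"
    using maximizer_sink[OF inj h(2)] by blast
  have "m = v" using c m(1) v(1) by (metis card_1_singletonE singletonD)
  then show ?thesis using m(2) v(2) by simp
qed

text \<open>A sink at the global minimum has no neighbour in its face, and by \<open>nbr_sub\<close>
  that face is then contained in \<open>{s}\<close>.\<close>

lemma sink_min:
  assumes "\<forall>v\<in>V-{s}. h s < h v" "s \<in> V"
  shows "sink_count h s = 1"
proof -
  have "{F \<in> \<F>. s \<in> sinks adj h F} = {{s}}"
  proof
    show "{F \<in> \<F>. s \<in> sinks adj h F} \<subseteq> {{s}}"
    proof
      fix F assume F: "F \<in> {F \<in> \<F>. s \<in> sinks adj h F}"
      have "F \<inter> Collect (adj s) \<subseteq> {s}" using F assms by (auto simp: sinks_def dest: adjD order_less_asym)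
      then have "F \<subseteq> {s}" using nbr_sub[of F "{s}" s] F vertex_face[OF assms(2)] by (auto simp: sinks_def)
      then show "F \<in> {{s}}" using F by (auto simp: sinks_def)
    qed
    show "{{s}} \<subseteq> {F \<in> \<F>. s \<in> sinks adj h F}" using vertex_face[OF assms(2)] by (auto simp: sinks_def dest: adjD)
  qed
  then show ?thesis by (simp add: sink_count_def)
qed

lemma sink_max:
  assumes "\<forall>v\<in>V-{t}. h v < h t"
  shows "sink_count h t = card {F \<in> \<F>. t \<in> F}"
proof -
  have "{F \<in> \<F>. t \<in> sinks adj h F} = {F \<in> \<F>. t \<in> F}"
    using assms by (auto simp: sinks_def dest: adjD)
  then show ?thesis by (simp add: sink_count_def)
qed

lemma card_split: "card \<F> = card {F \<in> \<F>. t \<in> F} + card {F \<in> \<F>. t \<notin> F}"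
proof -
  have "\<F> = {F \<in> \<F>. t \<in> F} \<union> {F \<in> \<F>. t \<notin> F}" by auto
  then show ?thesis using card_Un_disjoint[of "{F \<in> \<F>. t \<in> F}" "{F \<in> \<F>. t \<notin> F}"] finite_F by auto
qed

end

section \<open>Comparison of two face systems on one graph\<close>

locale two_face_systems = P: face_system V adj x y \<P> + Q: face_system V adj x y \<Q>
  for V :: "'v set" and adj x y \<P> \<Q>
begin

lemma swap: "two_face_systems V adj x y \<Q> \<P>"
  by unfold_locales

text \<open>In \<open>sum_card_sinks\<close> the terms of the simple vertices are the same for
  \<open>\<P>\<close> and \<open>\<Q>\<close> and cancel. The sum for \<open>\<P>\<close> equals
  \<open>card \<P>\<close>, while the sum for \<open>\<Q>\<close> is at least
  \<open>card \<Q>\<close>, with equality exactly when \<open>h\<close> is a height of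
  \<open>\<Q>\<close>.\<close>

lemma height_compare:
  assumes "height V adj \<P> h"
  shows "card \<Q> + P.sink_count h x + P.sink_count h y \<le> card \<P> + Q.sink_count h x + Q.sink_count h y"
    and "card \<P> + Q.sink_count h x + Q.sink_count h y \<le> card \<Q> + P.sink_count h x + P.sink_count h y
      \<Longrightarrow> height V adj \<Q> h"
proof -
  have inj: "inj_on h V" and g: "unique_sinks adj \<P> h" using assms by (auto simp: height_def)
  have p: "(\<Sum>F\<in>\<P>. card (sinks adj h F)) = card \<P>"
    using P.card_le_sum_sinks[OF inj] g by simp
  note q = Q.card_le_sum_sinks[OF inj]
  show "card \<Q> + P.sink_count h x + P.sink_count h y \<le> card \<P> + Q.sink_count h x + Q.sink_count h y"
    using p q(1) P.sum_card_sinks[of h] Q.sum_card_sinks[of h] by linarith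
  assume "card \<P> + Q.sink_count h x + Q.sink_count h y \<le> card \<Q> + P.sink_count h x + P.sink_count h y"
  then have "(\<Sum>F\<in>\<Q>. card (sinks adj h F)) \<le> card \<Q>"
    using p P.sum_card_sinks[of h] Q.sum_card_sinks[of h] by linarith
  then show "height V adj \<Q> h" using q(2) inj by (simp add: height_def)
qed

text \<open>The face of \<open>\<Q>\<close> spanned at the sink of \<open>F\<close> by the edges of \<open>F\<close> stays below that sink, hence in \<open>F\<close>.\<close>
lemma subface:
  assumes hP: "height V adj \<P> h" and hQ: "height V adj \<Q> h" and F: "F \<in> \<P>" "initial V h F"
    and z: "z \<in> sinks adj h F" "z \<notin> {x, y}"
  obtains G where "G \<in> \<Q>" "G \<subseteq> F" "z \<in> G" "\<And>v. v \<in> G - {x, y} \<Longrightarrow> F \<inter> Collect (adj v) = G \<inter> Collect (adj v)"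
    "(\<And>w. w \<in> {x, y} \<inter> G \<Longrightarrow> \<forall>v\<in>V-{w}. h w < h v) \<Longrightarrow> G = F"
proof -
  have zF: "z \<in> F" "z \<in> V - {x, y}" using z P.face_sub[OF F(1)] by (auto simp: sinks_def)
  obtain G where G: "G \<in> \<Q>" "z \<in> G" "G \<inter> Collect (adj z) = F \<inter> Collect (adj z)"
    using Q.span_face[OF zF(2), of "F \<inter> Collect (adj z)"] by auto
  have zG: "z \<in> sinks adj h G" using z(1) G by (auto simp: sinks_def)
  have inj: "inj_on h V" using hP by (simp add: height_def)
  have sub: "G \<subseteq> F"
  proof
    fix u assume u: "u \<in> G"
    have uV: "u \<in> V" using u Q.face_sub G by auto
    show "u \<in> F"
    proof (cases "u = z")
      case False
      then have "h u < h z" using Q.sink_maximizer[OF hQ G(1) zG u] uV zF by (intro inj_on_less[OF inj]) auto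
      then show ?thesis using F(2) zF uV by (auto simp: initial_def)
    qed (use zF in simp)
  qed
  \<comment> \<open>At every simple vertex of \<open>G\<close> the two faces have as many neighbours
    as at \<open>z\<close>, so the inclusion of neighbour sets is an equality.\<close>
  have nb: "F \<inter> Collect (adj v) = G \<inter> Collect (adj v)" if v: "v \<in> G - {x, y}" for v
  proof -
    have "card (G \<inter> Collect (adj v)) = card (G \<inter> Collect (adj z))" using Q.deg_face[OF G(1) v, of z] G zF by auto
    also have "\<dots> = card (F \<inter> Collect (adj z))" using G by simp
    also have "\<dots> = card (F \<inter> Collect (adj v))" using P.deg_face[OF F(1), of z v] sub v zF by auto
    finally show ?thesis using sub P.finite_face[OF F(1)]
      by (intro card_seteq[symmetric]) auto
  qed
  have eq: "G = F" if min: "\<And>w. w \<in> {x, y} \<inter> G \<Longrightarrow> \<forall>v\<in>V-{w}. h w < h v"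
  proof (rule ccontr)
    assume "G \<noteq> F"
    then have ne: "F - G \<noteq> {}" "finite (F - G)" using sub P.finite_face[OF F(1)] by auto
    \<comment> \<open>The highest vertex \<open>u\<close> of \<open>F\<close> outside
      \<open>G\<close> is not the unique sink \<open>z\<close>, so it has a higher neighbour
      \<open>w\<close> in \<open>F\<close>, which must lie in \<open>G\<close>. Once
      \<open>w\<close> is known to be simple, its neighbour \<open>u\<close> has to lie in
      \<open>G\<close> as well.\<close>
    obtain u where u: "u \<in> F - G" "\<And>w. w \<in> F - G \<Longrightarrow> h w \<le> h u"
      using finite_maximizer[OF ne(2,1), of h] by metis
    have "u \<notin> sinks adj h F"
    proof
      assume "u \<in> sinks adj h F"
      then have "u = z" using z(1) hP F(1)
        by (metis card_1_singletonE height_def singletonD unique_sinks_def)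
      then show False using u G by simp
    qed
    then obtain w where w: "w \<in> F" "adj u w" "\<not> h w < h u" using u by (auto simp: sinks_def)
    have "h w \<noteq> h u" using inj_onD[OF inj, of w u] P.adjD[OF w(2)] by auto
    then have lt: "h u < h w" using w by simp
    then have wG: "w \<in> G" using u(2)[of w] w by force
    \<comment> \<open>An exceptional vertex of \<open>G\<close> is assumed to be the strict minimum
      and cannot lie above \<open>u\<close>.\<close>
    have "w \<notin> {x, y}"
    proof
      assume "w \<in> {x, y}"
      then have "h w < h u" using min[of w] wG P.adjD[OF w(2)] by auto
      then show False using lt by simp
    qed
    then have "F \<inter> Collect (adj w) = G \<inter> Collect (adj w)" using nb wG by auto
    then show False using u P.adj_sym[OF w(2)] by blast
  qed
  show thesis by (rule that[OF G(1) sub G(2) nb eq])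
qed


lemma height_initial_sink:
  assumes "height V adj \<P> h" "F \<in> \<P>"
  obtains z where "z \<in> sinks adj h F"
  using P.sinks_nonempty[of h F] assms by (auto simp: height_def)

section \<open>Faces through exactly one exceptional vertex\<close>

text \<open>With \<open>s\<close> lowest and \<open>t\<close> highest, \<open>s\<close> is a sink of
  \<open>{s}\<close> only and \<open>t\<close> is a sink of every face through it. In
  \<open>height_compare\<close> this leaves the numbers of faces avoiding \<open>t\<close>; such a
  height exists by \<open>height_separating\<close> for the face \<open>{s}\<close>.\<close>

lemma card_avoiding_le:
  assumes st: "{s, t} = {x, y}"
  shows "card {F \<in> \<Q>. t \<notin> F} \<le> card {F \<in> \<P>. t \<notin> F}"
    and "height V adj \<P> h \<Longrightarrow> \<forall>v\<in>V-{s}. h s < h v \<Longrightarrow> \<forall>v\<in>V-{t}. h v < h t \<Longrightarrow>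
      card {F \<in> \<P>. t \<notin> F} \<le> card {F \<in> \<Q>. t \<notin> F} \<Longrightarrow> height V adj \<Q> h"
proof -
  have V: "s \<in> V" "t \<in> V" "s \<noteq> t" using st P.xy by (auto simp: doubleton_eq_iff)
  have sum: "f x + f y = f s + f t" for f :: "'v \<Rightarrow> nat" using st by (auto simp: doubleton_eq_iff)
  have cnt: "(card \<Q> + P.sink_count h x + P.sink_count h y \<le> card \<P> + Q.sink_count h x + Q.sink_count h y) \<longleftrightarrow>
      card {F \<in> \<Q>. t \<notin> F} \<le> card {F \<in> \<P>. t \<notin> F}"
    "(card \<P> + Q.sink_count h x + Q.sink_count h y \<le> card \<Q> + P.sink_count h x + P.sink_count h y) \<longleftrightarrow>
      card {F \<in> \<P>. t \<notin> F} \<le> card {F \<in> \<Q>. t \<notin> F}"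
    if "\<forall>v\<in>V-{s}. h s < h v" "\<forall>v\<in>V-{t}. h v < h t" for h
    using sum[of "P.sink_count h"] sum[of "Q.sink_count h"] P.sink_min[OF that(1) V(1)] Q.sink_min[OF that(1) V(1)]
      P.sink_max[OF that(2)] Q.sink_max[OF that(2)] P.card_split[of t] Q.card_split[of t] by linarith+
  have "\<exists>h. height V adj \<P> h \<and> initial V h {s} \<and> (\<forall>v\<in>V-{s}. h s < h v) \<and> (\<forall>v\<in>V-{t}. h v < h t)"
    using V by (intro P.height_separating P.vertex_face) auto
  then obtain h where h: "height V adj \<P> h" "\<forall>v\<in>V-{s}. h s < h v" "\<forall>v\<in>V-{t}. h v < h t" by blast
  show "card {F \<in> \<Q>. t \<notin> F} \<le> card {F \<in> \<P>. t \<notin> F}"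
    using height_compare(1)[OF h(1)] cnt(1)[OF h(2,3)] by blast
  show "height V adj \<Q> h" if "height V adj \<P> h" "\<forall>v\<in>V-{s}. h s < h v" "\<forall>v\<in>V-{t}. h v < h t"
    "card {F \<in> \<P>. t \<notin> F} \<le> card {F \<in> \<Q>. t \<notin> F}" for h
    using height_compare(2)[OF that(1)] cnt(2)[OF that(2,3)] that(4) by blast
qed

lemma card_avoiding_eq:
  assumes "{s, t} = {x, y}"
  shows "card {F \<in> \<Q>. t \<notin> F} = card {F \<in> \<P>. t \<notin> F}"
  using card_avoiding_le(1)[OF assms] two_face_systems.card_avoiding_le(1)[OF swap assms] by simp

text \<open>The height chosen has minimum \<open>s\<close> and maximum \<open>t\<close> and makes
  \<open>F\<close> initial; the equality of counts makes it a height of \<open>\<Q>\<close>. The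
  sink of \<open>F\<close> is simple unless \<open>F = {s}\<close>, and \<open>subface\<close> gives
  equality because \<open>s\<close> is the only exceptional vertex that \<open>G\<close> can
  contain.\<close>

lemma face_containing_one:
  assumes st: "{s, t} = {x, y}" and F: "F \<in> \<P>" "s \<in> F" "t \<notin> F"
  shows "F \<in> \<Q>"
proof (cases "F = {s}")
  case True
  then show ?thesis using Q.vertex_face P.face_sub[OF F(1)] by simp
next
  case False
  have V: "s \<in> V" "t \<in> V - F" using st P.xy F by (auto simp: doubleton_eq_iff)
  obtain h where h: "height V adj \<P> h" "initial V h F" "\<forall>v\<in>V-{s}. h s < h v" "\<forall>v\<in>V-{t}. h v < h t"
    using P.height_separating[OF F(1,2) V(2)] by blast
  have hQ: "height V adj \<Q> h"
    using card_avoiding_le(2)[OF st h(1,3,4)] card_avoiding_eq[OF st] by simp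
  obtain z where z: "z \<in> sinks adj h F" using height_initial_sink[OF h(1) F(1)] .
  obtain v where v: "v \<in> F" "v \<noteq> s" using False F(2) by blast
  have "h v \<le> h z" using P.sink_maximizer[OF h(1) F(1) z v(1)] .
  moreover have "h s < h v" using h(3) v P.face_sub[OF F(1)] by auto
  ultimately have "z \<noteq> s" by auto
  moreover have "z \<noteq> t" using z F(3) by (auto simp: sinks_def)
  ultimately have "z \<notin> {x, y}" using st by (metis insertE singletonD)
  from subface[OF h(1) hQ F(1) h(2) z this] obtain G where G: "G \<in> \<Q>" "G \<subseteq> F"
    "(\<And>w. w \<in> {x, y} \<inter> G \<Longrightarrow> \<forall>v\<in>V-{w}. h w < h v) \<Longrightarrow> G = F" by metis
  have "G = F"
  proof (rule G(3))
    fix w assume w: "w \<in> {x, y} \<inter> G"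
    then have "w = s" using F(3) G(2) unfolding st[symmetric] by auto
    then show "\<forall>v\<in>V-{w}. h w < h v" using h(3) by simp
  qed
  then show ?thesis using G(1) by simp
qed

lemma faces_containing_one:
  assumes "{s, t} = {x, y}"
  shows "{F \<in> \<P>. s \<in> F \<and> t \<notin> F} = {F \<in> \<Q>. s \<in> F \<and> t \<notin> F}"
  using face_containing_one[OF assms] two_face_systems.face_containing_one[OF swap assms] by blast

end

section \<open>Faces through both exceptional vertices\<close>

context face_system
begin

definition both :: "'v set set" where "both = {F \<in> \<F>. x \<in> F \<and> y \<in> F}"

text \<open>These are the faces through both exceptional vertices that are lost at \<open>y\<close>.
  Once the faces through exactly one of \<open>x\<close>, \<open>y\<close> are known,
  \<open>both\<close> and \<open>sunk h\<close> are what remains unknown in the comparison for a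
  height with minimum \<open>x\<close>.\<close>

definition sunk :: "('v \<Rightarrow> real) \<Rightarrow> 'v set set" where "sunk h = {F \<in> \<F>. x \<in> F \<and> y \<in> sinks adj h F}"

lemma card_both: "card \<F> = card {F \<in> \<F>. y \<notin> F} + card {F \<in> \<F>. y \<in> F \<and> x \<notin> F} + card both"
proof -
  have "{F \<in> \<F>. y \<in> F} = {F \<in> \<F>. y \<in> F \<and> x \<notin> F} \<union> both" by (auto simp: both_def)
  moreover have "{F \<in> \<F>. y \<in> F \<and> x \<notin> F} \<inter> both = {}" by (auto simp: both_def)
  ultimately have "card {F \<in> \<F>. y \<in> F} = card {F \<in> \<F>. y \<in> F \<and> x \<notin> F} + card both"
    using card_Un_disjoint[of "{F \<in> \<F>. y \<in> F \<and> x \<notin> F}" both] finite_F by (simp add: both_def)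
  then show ?thesis using card_split[of y] by simp
qed

lemma sink_count_sunk:
  "sink_count h y = card {F \<in> {F \<in> \<F>. y \<in> F \<and> x \<notin> F}. y \<in> sinks adj h F} + card (sunk h)"
proof -
  have "{F \<in> \<F>. y \<in> sinks adj h F} = {F \<in> {F \<in> \<F>. y \<in> F \<and> x \<notin> F}. y \<in> sinks adj h F} \<union> sunk h"
    by (auto simp: sunk_def sinks_def)
  moreover have "{F \<in> {F \<in> \<F>. y \<in> F \<and> x \<notin> F}. y \<in> sinks adj h F} \<inter> sunk h = {}" by (auto simp: sunk_def)
  ultimately show ?thesis using finite_F card_Un_disjoint[of "{F \<in> {F \<in> \<F>. y \<in> F \<and> x \<notin> F}. y \<in> sinks adj h F}" "sunk h"]
    by (simp add: sink_count_def sunk_def)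
qed

text \<open>The only lower neighbour of \<open>y\<close> is \<open>x\<close>, so
  \<open>nbr_sub\<close> against the edge confines every such face to \<open>{x, y}\<close>.\<close>

lemma sunk_adjacent:
  assumes "adj x y" "h x < h y" "\<And>v. v \<in> V \<Longrightarrow> h v < h y \<Longrightarrow> v = x"
  shows "sunk h = {{x, y}}"
proof
  show "{{x, y}} \<subseteq> sunk h"
    using edge_face[OF assms(1)] assms(2) by (auto simp: sunk_def sinks_def dest: adjD)
  show "sunk h \<subseteq> {{x, y}}"
  proof
    fix F assume F: "F \<in> sunk h"
    then have F': "F \<in> \<F>" "x \<in> F" "y \<in> F" by (auto simp: sunk_def sinks_def)
    have "F \<inter> Collect (adj y) \<subseteq> {x, y}"
    proof
      fix u assume "u \<in> F \<inter> Collect (adj y)"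
      then have "h u < h y" "u \<in> V" using F adjD[of y u] by (auto simp: sunk_def sinks_def)
      then show "u \<in> {x, y}" using assms(3) by simp
    qed
    then have "F \<subseteq> {x, y}" using nbr_sub[OF F'(1) edge_face[OF assms(1)] F'(3)] by simp
    then show "F \<in> {{x, y}}" using F' by auto
  qed
qed

end

context two_face_systems
begin

text \<open>With \<open>x\<close> as minimum, its sink count is 1 in both systems. The faces
  avoiding \<open>y\<close> agree in number and the faces through \<open>y\<close> but not
  \<open>x\<close> agree as sets, so \<open>height_compare\<close> reduces to \<open>both\<close>
  and \<open>sunk\<close>.\<close>

lemma compare_source:
  assumes h: "height V adj \<P> h" "\<forall>v\<in>V-{x}. h x < h v"
  shows "card Q.both + card (P.sunk h) \<le> card P.both + card (Q.sunk h)"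
    and "card P.both + card (Q.sunk h) \<le> card Q.both + card (P.sunk h) \<Longrightarrow> height V adj \<Q> h"
proof -
  have st: "{x, y} = {x, y}" "{y, x} = {x, y}" by auto
  note eqs = P.sink_min[OF h(2) P.xy(1)] Q.sink_min[OF h(2) P.xy(1)] P.sink_count_sunk[of h] Q.sink_count_sunk[of h]
    P.card_both Q.card_both card_avoiding_eq[OF st(1)]
  have fe: "{F \<in> \<P>. y \<in> F \<and> x \<notin> F} = {F \<in> \<Q>. y \<in> F \<and> x \<notin> F}" using faces_containing_one[OF st(2)] .
  show "card Q.both + card (P.sunk h) \<le> card P.both + card (Q.sunk h)"
    using height_compare(1)[OF h(1)] eqs unfolding fe by linarith
  assume "card P.both + card (Q.sunk h) \<le> card Q.both + card (P.sunk h)"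
  then show "height V adj \<Q> h"
    using eqs unfolding fe by (intro height_compare(2)[OF h(1)]) linarith
qed

text \<open>If \<open>x\<close> and \<open>y\<close> are not adjacent and \<open>y\<close> were a sink of faces \<open>G1\<close>, \<open>G2\<close> of \<open>\<Q>\<close> through \<open>x\<close> for the two
  heights provided, then \<open>y\<close> would be isolated in \<open>G1 \<inter> G2\<close>.\<close>
lemma balanced_height:
  assumes F: "F \<in> \<P>" "x \<in> F" "y \<in> F"
  obtains h where "height V adj \<P> h" "initial V h F" "\<forall>v\<in>V-{x}. h x < h v" "card (P.sunk h) = card (Q.sunk h)"
    "F \<in> P.sunk h \<Longrightarrow> F = {x, y}"
proof (cases "adj x y")
  case True
  from P.height_adjacent[OF F True]
  obtain h where h: "height V adj \<P> h" "initial V h F" "\<forall>v\<in>V-{x}. h x < h v" "\<forall>v\<in>V. h v < h y \<longrightarrow> v = x" by blast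
  have "h x < h y" using h(3) P.xy by auto
  \<comment> \<open>In either system the edge itself is the only face through \<open>x\<close> with
    sink \<open>y\<close>.\<close>
  then have s: "P.sunk h = {{x, y}}" "Q.sunk h = {{x, y}}"
    using h(4) by (intro P.sunk_adjacent[OF True] Q.sunk_adjacent[OF True]; blast)+
  show ?thesis
  proof (rule that[OF h(1-3)])
    show "card (P.sunk h) = card (Q.sunk h)" unfolding s by (rule refl)
    show "F = {x, y}" if "F \<in> P.sunk h" using that unfolding s by (rule singletonD)
  qed
next
  case False
  from P.height_nonadjacent[OF F False]
  obtain h1 h2 where h: "\<forall>h\<in>{h1, h2}. height V adj \<P> h \<and> initial V h F \<and> (\<forall>v\<in>V-{x}. h x < h v) \<and>
            (\<forall>G\<in>\<P>. x \<in> G \<longrightarrow> y \<notin> sinks adj h G)"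
     and d: "\<forall>u. adj y u \<longrightarrow> \<not> (h1 u < h1 y \<and> h2 u < h2 y)" by (elim exE conjE)
  have P0: "P.sunk h = {}" if "h \<in> {h1, h2}" for h using bspec[OF h that] unfolding P.sunk_def by blast
  have "\<exists>h\<in>{h1, h2}. Q.sunk h = {}"
  proof (rule ccontr)
    assume "\<not> ?thesis"
    then obtain G1 G2 where G: "G1 \<in> Q.sunk h1" "G2 \<in> Q.sunk h2" by blast
    then have xy: "x \<in> G1 \<inter> G2" "y \<in> G1 \<inter> G2" by (auto simp: Q.sunk_def sinks_def)
    have "G1 \<inter> G2 \<in> \<Q>" using G xy(1) by (intro Q.Int_face) (auto simp: Q.sunk_def)
    moreover have "G1 \<inter> G2 \<inter> Collect (adj y) \<subseteq> {y}"
    proof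
      fix u assume u: "u \<in> G1 \<inter> G2 \<inter> Collect (adj y)"
      then have "h1 u < h1 y" "h2 u < h2 y" using G by (simp_all add: Q.sunk_def sinks_def)
      then show "u \<in> {y}" using d u by blast
    qed
    ultimately have "G1 \<inter> G2 \<subseteq> {y}" using Q.nbr_sub[of "G1 \<inter> G2" "{y}" y] Q.vertex_face[OF P.xy(2)] xy by simp
    then show False using xy P.xy by blast
  qed
  then obtain h where hh: "h \<in> {h1, h2}" "Q.sunk h = {}" by blast
  show ?thesis
  proof (rule that)
    show "height V adj \<P> h" "initial V h F" "\<forall>v\<in>V-{x}. h x < h v" using bspec[OF h hh(1)] by blast+
    show "card (P.sunk h) = card (Q.sunk h)" using P0[OF hh(1)] hh(2) by simp
    show "F = {x, y}" if "F \<in> P.sunk h" using that P0[OF hh(1)] by simp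
  qed
qed

text \<open>Only the counts matter here, so the balanced height is taken with \<open>V\<close> as
  initial face; the two \<open>sunk\<close> terms cancel in \<open>compare_source\<close>.\<close>

lemma card_both_le: "card Q.both \<le> card P.both"
proof -
  obtain h where "height V adj \<P> h" "\<forall>v\<in>V-{x}. h x < h v" "card (P.sunk h) = card (Q.sunk h)"
    using balanced_height[OF P.top_face P.xy(1,2)] by metis
  then show ?thesis using compare_source(1)[of h] by simp
qed

lemma card_both_eq: "card Q.both = card P.both"
  using card_both_le two_face_systems.card_both_le[OF swap] by simp

text \<open>\<open>subface\<close> yields only an inclusion, as \<open>y\<close> is not the minimum
  of the height. If \<open>G\<close> missed \<open>y\<close>, it would equal \<open>F\<close>, which
  contains \<open>y\<close>. If it missed \<open>x\<close>, it would be a face of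
  \<open>\<P>\<close> by the previous stage, with the same neighbours at \<open>z\<close> as
  \<open>F\<close>, and would contain \<open>F\<close>.\<close>

lemma subface_containing_both:
  assumes F: "F \<in> \<P>" "x \<in> F" "y \<in> F" "F \<noteq> {x, y}"
  obtains G z where "G \<in> \<Q>" "G \<subseteq> F" "x \<in> G" "y \<in> G" "z \<in> G - {x, y}"
    "\<And>v. v \<in> G - {x, y} \<Longrightarrow> F \<inter> Collect (adj v) = G \<inter> Collect (adj v)"
proof -
  obtain h where h: "height V adj \<P> h" "initial V h F" "\<forall>v\<in>V-{x}. h x < h v" "card (P.sunk h) = card (Q.sunk h)"
    "F \<in> P.sunk h \<Longrightarrow> F = {x, y}"
    using balanced_height[OF F(1-3)] by metis
  have hQ: "height V adj \<Q> h" using compare_source(2)[OF h(1,3)] h(4) card_both_eq by simp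
  obtain z where z: "z \<in> sinks adj h F" using height_initial_sink[OF h(1) F(1)] .
  have "z \<noteq> y" using h(5) F z by (auto simp: P.sunk_def)
  moreover have "h x < h y" using h(3) P.xy by blast
  then have "z \<noteq> x" using P.sink_maximizer[OF h(1) F(1) z F(3)] by (metis not_less)
  ultimately have zs: "z \<notin> {x, y}" by simp
  from subface[OF h(1) hQ F(1) h(2) z zs] obtain G where G: "G \<in> \<Q>" "G \<subseteq> F" "z \<in> G"
    "\<And>v. v \<in> G - {x, y} \<Longrightarrow> F \<inter> Collect (adj v) = G \<inter> Collect (adj v)"
    "(\<And>w. w \<in> {x, y} \<inter> G \<Longrightarrow> \<forall>v\<in>V-{w}. h w < h v) \<Longrightarrow> G = F" by metis
  have yG: "y \<in> G"
  proof (rule ccontr)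
    assume "y \<notin> G"
    then have "G = F" using h(3) by (intro G(5)) auto
    then show False using F \<open>y \<notin> G\<close> by simp
  qed
  have xG: "x \<in> G"
  proof (rule ccontr)
    assume x: "x \<notin> G"
    have "G \<in> \<P>" using two_face_systems.face_containing_one[OF swap _ G(1) yG x] by auto
    then have "F \<subseteq> G" using P.nbr_sub[OF F(1) _ _ G(3)] G zs by blast
    then show False using x F by blast
  qed
  show thesis using that[OF G(1,2) xG yG _ G(4), of z] G(3) zs by simp
qed

text \<open>Passing from \<open>\<P>\<close> to \<open>\<Q>\<close> and back gives
  \<open>H \<subseteq> G \<subseteq> F\<close> with \<open>H\<close> in \<open>\<P>\<close>. The
  neighbours of \<open>w\<close> in \<open>F\<close> and in \<open>H\<close> coincide, so
  \<open>nbr_sub\<close> closes the chain.\<close>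

lemma face_containing_both:
  assumes F: "F \<in> \<P>" "x \<in> F" "y \<in> F"
  shows "F \<in> \<Q>"
proof (cases "F = {x, y}")
  case True
  \<comment> \<open>Otherwise \<open>x\<close> would have no neighbour in \<open>F\<close>, and
    \<open>nbr_sub\<close> would force \<open>F\<close> into \<open>{x}\<close>.\<close>
  have "adj x y"
  proof (rule ccontr)
    assume n: "\<not> adj x y"
    have "\<not> adj y x" using n P.adj_sym by blast
    then have "F \<inter> Collect (adj x) \<subseteq> {x}" using True n by auto
    then have "F \<subseteq> {x}" using P.nbr_sub[OF F(1) P.vertex_face[OF P.xy(1)]] F by simp
    then show False using F P.xy by auto
  qed
  then show ?thesis using Q.edge_face True by simp
next
  case False
  obtain G z where G: "G \<in> \<Q>" "G \<subseteq> F" "x \<in> G" "y \<in> G" "z \<in> G - {x, y}"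
    and GF: "\<And>v. v \<in> G - {x, y} \<Longrightarrow> F \<inter> Collect (adj v) = G \<inter> Collect (adj v)"
    using subface_containing_both[OF F False] by metis
  then have "G \<noteq> {x, y}" by auto
  from two_face_systems.subface_containing_both[OF swap G(1,3,4) this]
  obtain H w where H: "H \<in> \<P>" "H \<subseteq> G" "w \<in> H - {x, y}" "\<And>v. v \<in> H - {x, y} \<Longrightarrow> G \<inter> Collect (adj v) = H \<inter> Collect (adj v)"
    by metis
  have "F \<inter> Collect (adj w) = H \<inter> Collect (adj w)" using GF[of w] H(4)[OF H(3)] H(2,3) by auto
  moreover have "w \<in> F" using G(2) H(2,3) by auto
  ultimately have "F \<subseteq> H" using P.nbr_sub[OF F(1) H(1), of w] H(3) by blast
  then have "G = F" using G(2) H(2) by simp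
  then show ?thesis using G(1) by simp
qed

section \<open>From the faces through exceptional vertices to all faces\<close>

lemma faces_containing:
  "{F \<in> \<P>. x \<in> F \<or> y \<in> F} = {F \<in> \<Q>. x \<in> F \<or> y \<in> F}"
proof -
  have st: "{x, y} = {x, y}" "{y, x} = {x, y}" by auto
  show ?thesis
    using face_containing_both two_face_systems.face_containing_both[OF swap]
      faces_containing_one[OF st(1)] faces_containing_one[OF st(2)] by blast
qed

text \<open>By \<open>faces_containing\<close> the sink counts at \<open>x\<close> and
  \<open>y\<close> agree for every height, and the total numbers of faces agree too, so every height
  of \<open>\<P>\<close> is a height of \<open>\<Q>\<close>. A face avoiding \<open>x\<close> and
  \<open>y\<close> has a simple sink, and the condition on exceptional vertices in
  \<open>subface\<close> is vacuous for it.\<close>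

lemma faces_subset: "\<P> \<subseteq> \<Q>"
proof
  fix F assume F: "F \<in> \<P>"
  show "F \<in> \<Q>"
  proof (cases "x \<in> F \<or> y \<in> F")
    case True
    then show ?thesis using faces_containing F by blast
  next
    case False
    obtain h where h: "height V adj \<P> h" "initial V h F" using P.height_initial[OF F] by blast
    have sc: "P.sink_count h v = Q.sink_count h v" if "v \<in> {x, y}" for v
    proof -
      have "{F \<in> \<P>. v \<in> sinks adj h F} = {F \<in> \<Q>. v \<in> sinks adj h F}"
        using faces_containing that by (auto simp: sinks_def)
      then show ?thesis by (simp add: P.sink_count_def Q.sink_count_def)
    qed
    have "{F \<in> \<P>. y \<in> F} = {F \<in> \<Q>. y \<in> F}" using faces_containing by blast
    then have "card \<P> = card \<Q>"
      using P.card_split[of y] Q.card_split[of y] card_avoiding_eq[of x y] by simp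
    then have hQ: "height V adj \<Q> h" using height_compare(2)[OF h(1)] sc by simp
    obtain z where z: "z \<in> sinks adj h F" using height_initial_sink[OF h(1) F] .
    then have "z \<notin> {x, y}" using False by (auto simp: sinks_def)
    from subface[OF h(1) hQ F h(2) z this] obtain G where G: "G \<in> \<Q>" "G \<subseteq> F"
      "(\<And>w. w \<in> {x, y} \<inter> G \<Longrightarrow> \<forall>v\<in>V-{w}. h w < h v) \<Longrightarrow> G = F" by metis
    have "G = F" using False G(2) by (intro G(3)) auto
    then show ?thesis using G(1) by simp
  qed
qed

theorem face_systems_eq: "\<P> = \<Q>"
  using faces_subset two_face_systems.faces_subset[OF swap] by blast

end

section \<open>Linear functionals and simple vertices of polytopes\<close>

lemma poly_vertices_extreme: "poly_vertices P = {v. v extreme_point_of P}"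
  by (simp add: poly_vertices_def face_of_singleton)

lemma finite_poly_vertices: "polytope P \<Longrightarrow> finite (poly_vertices P)"
  by (simp add: poly_vertices_extreme finite_polyhedron_extreme_points polytope_imp_polyhedron)

lemma poly_vertices_subset: "poly_vertices P \<subseteq> P"
  by (auto simp: poly_vertices_def dest: face_of_imp_subset)

lemma polytope_hull_vertices: "polytope P \<Longrightarrow> convex hull (poly_vertices P) = P"
  using Krein_Milman_Minkowski[of P]
  by (simp add: poly_vertices_extreme polytope_imp_compact polytope_imp_convex)

lemma poly_vertices_face: "F face_of P \<Longrightarrow> poly_vertices F = poly_vertices P \<inter> F"
  by (auto simp: poly_vertices_extreme extreme_point_of_face)

lemma polytope_inner_le:
  assumes "polytope P" "\<And>v. v \<in> poly_vertices P \<Longrightarrow> c \<bullet> v \<le> b" "p \<in> P"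
  shows "c \<bullet> p \<le> b"
proof -
  have "convex hull (poly_vertices P) \<subseteq> {x. c \<bullet> x \<le> b}"
    using assms(2) by (intro hull_minimal) (auto simp: convex_halfspace_le)
  then show ?thesis using polytope_hull_vertices[OF assms(1)] assms(3) by auto
qed

lemma poly_adjD: "poly_adj P u v \<Longrightarrow> u \<in> poly_vertices P \<and> v \<in> poly_vertices P \<and> u \<noteq> v"
  by (simp add: poly_adj_def)

lemma poly_adj_irrefl [simp]: "\<not> poly_adj P v v"
  by (simp add: poly_adj_def)

lemma poly_adj_sym: "poly_adj P u v \<Longrightarrow> poly_adj P v u"
  by (auto simp: poly_adj_def)

lemma edge_segment:
  assumes P: "polytope P" and E: "E face_of P" "aff_dim E = 1"
  obtains u v where "u \<noteq> v" "E = closed_segment u v" "poly_vertices P \<inter> E = {u, v}"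
proof -
  have pE: "polytope E" using face_of_polytope_polytope[OF P E(1)] .
  have "E \<noteq> {}" "collinear E" using E(2) by (auto simp: collinear_aff_dim)
  then obtain u v where uv: "E = closed_segment u v"
    using compact_convex_collinear_segment[of E] polytope_imp_compact[OF pE] polytope_imp_convex[OF pE] by metis
  have "u \<noteq> v" using uv E(2) by auto
  moreover have "poly_vertices P \<inter> E = {u, v}"
    using poly_vertices_face[OF E(1)] unfolding poly_vertices_extreme uv by (auto simp: extreme_point_of_segment)
  ultimately show thesis using that uv by blast
qed

lemma poly_adj_segment_face:
  assumes "polytope P" "poly_adj P u v"
  shows "closed_segment u v face_of P" "poly_vertices P \<inter> closed_segment u v = {u, v}"
proof -
  obtain E where E: "E face_of P" "aff_dim E = 1" "u \<in> E" "v \<in> E" and uv: "u \<in> poly_vertices P" "v \<in> poly_vertices P" "u \<noteq> v"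
    using assms(2) by (auto simp: poly_adj_def)
  obtain a b where ab: "a \<noteq> b" "E = closed_segment a b" "poly_vertices P \<inter> E = {a, b}"
    using edge_segment[OF assms(1) E(1,2)] .
  have "u \<in> {a, b}" "v \<in> {a, b}" using ab(3) E uv by blast+
  then have eq: "{a, b} = {u, v}" using uv(3) by auto
  then have "E = closed_segment u v" using ab(2) by (simp add: segment_convex_hull)
  then show "closed_segment u v face_of P" "poly_vertices P \<inter> closed_segment u v = {u, v}"
    using E(1) ab(3) eq by simp_all
qed

text \<open>An edge between two vertices of \<open>F\<close> is a segment, lies in \<open>F\<close>
  by convexity and is therefore a face of \<open>F\<close>. This transfers statements about the
  graph of a polytope to its faces.\<close>

lemma poly_adj_face:
  assumes "polytope P" "F face_of P"
  shows "poly_adj F u v \<longleftrightarrow> poly_adj P u v \<and> u \<in> F \<and> v \<in> F"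
proof
  assume l: "poly_adj F u v"
  then have "u \<in> F" "v \<in> F" using poly_vertices_subset by (auto simp: poly_adj_def)
  then show "poly_adj P u v \<and> u \<in> F \<and> v \<in> F"
    using l poly_vertices_face[OF assms(2)] face_of_trans[OF _ assms(2)] by (auto simp: poly_adj_def)
next
  assume r: "poly_adj P u v \<and> u \<in> F \<and> v \<in> F"
  have "closed_segment u v \<subseteq> F" using r face_of_imp_convex[OF assms(2)] by (simp add: closed_segment_subset)
  then have "closed_segment u v face_of F"
    using poly_adj_segment_face(1)[OF assms(1)] r face_of_imp_subset[OF assms(2)] by (meson face_of_subset)
  moreover have "aff_dim (closed_segment u v) = 1" using r
    by (simp add: segment_convex_hull aff_dim_convex_hull poly_adj_def)
  ultimately show "poly_adj F u v"
    using r poly_vertices_face[OF assms(2)] by (auto simp: poly_adj_def intro!: exI[of _ "closed_segment u v"])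
qed

text \<open>An extreme point of a hyperplane section lies on a face of dimension at most one: otherwise it could be
  moved both ways inside the section of the face having it in its relative interior.\<close>
lemma extreme_point_of_slice:
  fixes P :: "'a::euclidean_space set"
  assumes P: "polytope P" and q: "q extreme_point_of (P \<inter> {x. a \<bullet> x = b})"
  obtains E where "E face_of P" "q \<in> E" "aff_dim E \<le> 1"
proof -
  have qP: "q \<in> P" "a \<bullet> q = b" using q by (auto simp: extreme_point_of_def)
  \<comment> \<open>A face of least dimension through \<open>q\<close> will have \<open>q\<close> in
    its relative interior.\<close>
  have "\<exists>E. (E face_of P \<and> q \<in> E) \<and> (\<forall>F. (F face_of P \<and> q \<in> F) \<longrightarrow> nat (aff_dim E) \<le> nat (aff_dim F))"
    by (rule ex_has_least_nat[of _ P]) (simp add: qP face_of_refl polytope_imp_convex[OF P])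
  then obtain E where E: "E face_of P" "q \<in> E" and least: "\<And>F. F face_of P \<Longrightarrow> q \<in> F \<Longrightarrow> nat (aff_dim E) \<le> nat (aff_dim F)"
    by blast
  have pE: "polyhedron E" "convex E"
    using face_of_polytope_polytope[OF P E(1)] by (auto simp: polytope_imp_polyhedron polytope_imp_convex)
  have "q \<in> rel_interior E"
  proof (rule ccontr)
    assume "q \<notin> rel_interior E"
    then have "q \<in> \<Union> {F. F facet_of E}" using E(2) unfolding rel_boundary_of_polyhedron[OF pE(1), symmetric] by simp
    then obtain F where F: "F facet_of E" "q \<in> F" by auto
    have "F face_of E" "aff_dim F = aff_dim E - 1" using F(1) unfolding facet_of_def by blast+
    \<comment> \<open>A facet containing \<open>q\<close> is nonempty, so its dimension is at least
      0 and \<open>nat\<close> does not hide the drop by one.\<close>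
    moreover have "aff_dim F \<noteq> -1" using F(2) by (auto simp flip: aff_dim_empty)
    moreover have "- 1 \<le> aff_dim F" by (rule aff_dim_geq)
    moreover have "nat (aff_dim E) \<le> nat (aff_dim F)"
      using face_of_trans[OF \<open>F face_of E\<close> E(1)] F(2) by (rule least)
    ultimately show False by linarith
  qed
  then obtain e where e: "e > 0" "cball q e \<inter> affine hull E \<subseteq> E" by (auto simp: mem_rel_interior_cball)
  have "aff_dim E \<le> 1"
  proof (rule ccontr)
    assume n: "\<not> aff_dim E \<le> 1"
    let ?A = "affine hull E \<inter> {x. a \<bullet> x = b}"
    have aff: "affine ?A" by (intro affine_Int affine_affine_hull affine_hyperplane)
    have qA: "q \<in> ?A" using E(2) qP(2) by (simp add: hull_inc)
    have "aff_dim ?A \<ge> 1" using aff_dim_affine_Int_hyperplane[of "affine hull E" a b] qA n by auto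
    then have "?A \<noteq> {q}" using aff_dim_sing[of q] by (metis not_one_le_zero)
    then obtain r where r: "r \<in> ?A" "r \<noteq> q" using qA by blast
    \<comment> \<open>This scale puts two opposite points of the section at distance exactly
      \<open>e\<close> from \<open>q\<close>, hence still in \<open>E\<close>.\<close>
    define t where "t = e / norm (r - q)"
    have t: "t > 0" "t * norm (r - q) = e" using r e(1) by (auto simp: t_def)
    have in_A: "q + s *\<^sub>R (r - q) \<in> ?A" for s
      using mem_affine[OF aff qA r(1), of "1 - s" s] by (simp add: algebra_simps)
    have in_E: "q + s *\<^sub>R (r - q) \<in> P \<inter> {x. a \<bullet> x = b}" if "\<bar>s\<bar> = t" for s
    proof -
      have "norm (s *\<^sub>R (r - q)) = e" using that t by simp
      then have "q + s *\<^sub>R (r - q) \<in> cball q e" by (simp add: dist_norm)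
      then have "q + s *\<^sub>R (r - q) \<in> E" using e(2) in_A by blast
      then show ?thesis using in_A face_of_imp_subset[OF E(1)] by blast
    qed
    have mid: "q = midpoint (q + t *\<^sub>R (r - q)) (q + (-t) *\<^sub>R (r - q))"
      by (simp add: midpoint_def algebra_simps flip: scaleR_2)
    have ne: "q + t *\<^sub>R (r - q) \<noteq> q + (-t) *\<^sub>R (r - q)" using t r by (auto simp: algebra_simps simp flip: scaleR_2)
    then have "q \<in> open_segment (q + t *\<^sub>R (r - q)) (q + (-t) *\<^sub>R (r - q))"
      using midpoint_in_open_segment mid by metis
    moreover have "q + t *\<^sub>R (r - q) \<in> P \<inter> {x. a \<bullet> x = b}" "q + (-t) *\<^sub>R (r - q) \<in> P \<inter> {x. a \<bullet> x = b}"
      using t(1) by (intro in_E; simp)+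
    ultimately show False using q unfolding extreme_point_of_def by blast
  qed
  then show thesis using that E by blast
qed

section \<open>Exposing functionals and local maxima\<close>

lemma face_exposing:
  fixes P :: "'a::euclidean_space set"
  assumes "polytope P" "F face_of P"
  obtains a b where "\<forall>p\<in>P. b \<le> a \<bullet> p" "F = P \<inter> {x. a \<bullet> x = b}"
proof -
  have "F exposed_face_of P" using assms exposed_face_of_polyhedron polytope_imp_polyhedron by blast
  then obtain a b where "P \<subseteq> {x. a \<bullet> x \<le> b}" "F = P \<inter> {x. a \<bullet> x = b}" by (auto simp: exposed_face_of_def)
  then show thesis by (intro that[of "-b" "-a"]) auto
qed

lemma vertex_exposing:
  fixes P :: "'a::euclidean_space set"
  assumes P: "polytope P" and v: "v \<in> poly_vertices P"
  shows "\<exists>a. \<forall>u\<in>poly_vertices P - {v}. a \<bullet> v < a \<bullet> u"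
proof -
  have "{v} face_of P" using v by (simp add: poly_vertices_def)
  then obtain a b where ab: "\<forall>p\<in>P. b \<le> a \<bullet> p" "{v} = P \<inter> {x. a \<bullet> x = b}" by (rule face_exposing[OF P])
  have "a \<bullet> v < a \<bullet> u" if "u \<in> poly_vertices P - {v}" for u
  proof -
    have "u \<in> P" "u \<noteq> v" using that poly_vertices_subset by auto
    moreover from this have "a \<bullet> u \<noteq> b" using ab(2) by blast
    moreover have "a \<bullet> v = b" using ab(2) by blast
    ultimately show ?thesis using ab(1) by force
  qed
  then show ?thesis by blast
qed

text \<open>The proof intersects \<open>P\<close> with a hyperplane that cuts off \<open>v\<close>; the section has its vertices on edges at \<open>v\<close>.\<close>
lemma vertex_local_max:
  fixes P :: "'a::euclidean_space set"
  assumes P: "polytope P" and v: "v \<in> poly_vertices P" and c: "\<And>u. poly_adj P v u \<Longrightarrow> c \<bullet> u \<le> c \<bullet> v"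
    and p: "p \<in> P"
  shows "c \<bullet> p \<le> c \<bullet> v"
proof (rule polytope_inner_le[OF P _ p])
  fix w assume w: "w \<in> poly_vertices P"
  show "c \<bullet> w \<le> c \<bullet> v"
  proof (cases "w = v")
    case False
    obtain a where a: "\<And>u. u \<in> poly_vertices P - {v} \<Longrightarrow> a \<bullet> v < a \<bullet> u" using vertex_exposing[OF P v] by blast
    define m where "m = Min ((\<bullet>) a ` (poly_vertices P - {v}))"
    have fin: "finite ((\<bullet>) a ` (poly_vertices P - {v}))" "(\<bullet>) a ` (poly_vertices P - {v}) \<noteq> {}"
      using finite_poly_vertices[OF P] w False by auto
    have "a \<bullet> v < m" unfolding m_def using fin a by (subst Min_gr_iff) auto
    moreover have "m \<le> a \<bullet> u" if "u \<in> poly_vertices P - {v}" for u using that fin by (auto simp: m_def)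
    \<comment> \<open>The level lies halfway between \<open>v\<close> and the lowest other vertex,
      so the hyperplane contains no vertex and has only \<open>v\<close> below it.\<close>
    moreover define b where "b = (a \<bullet> v + m) / 2"
    ultimately have b: "a \<bullet> v < b" "\<And>u. u \<in> poly_vertices P - {v} \<Longrightarrow> b < a \<bullet> u" by fastforce+
    let ?H = "P \<inter> {x. a \<bullet> x = b}"
    have pH: "polytope ?H" using P by (intro polytope_Int_polyhedron polyhedron_hyperplane)
    have ext: "c \<bullet> q \<le> c \<bullet> v" if "q \<in> poly_vertices ?H" for q
    proof -
      have q: "q extreme_point_of ?H" using that by (simp add: poly_vertices_extreme)
      then have qb: "a \<bullet> q = b" by (auto simp: extreme_point_of_def)
      obtain E where E: "E face_of P" "q \<in> E" "aff_dim E \<le> 1" using extreme_point_of_slice[OF P q] .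
      have "aff_dim E \<noteq> 0"
      proof
        assume "aff_dim E = 0"
        then have "E = {q}" using E(2) by (auto simp: aff_dim_eq_0)
        then have "q \<in> poly_vertices P" using E by (simp add: poly_vertices_def)
        then show False using b qb by (cases "q = v") auto
      qed
      moreover have "aff_dim E \<noteq> -1" using E(2) by (auto simp flip: aff_dim_empty)
      ultimately have E1: "aff_dim E = 1" using E(3) aff_dim_geq[of E] by linarith
      obtain r s where rs: "r \<noteq> s" "E = closed_segment r s" "poly_vertices P \<inter> E = {r, s}"
        using edge_segment[OF P E(1) E1] .
      \<comment> \<open>An edge with both ends above the level cannot meet the hyperplane in
        \<open>q\<close>.\<close>
      have "v \<in> {r, s}"
      proof (rule ccontr)
        assume "v \<notin> {r, s}"
        then have "b < a \<bullet> r" "b < a \<bullet> s" using rs(3) b(2) by auto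
        then have "E \<subseteq> {x. b < a \<bullet> x}"
          unfolding rs(2) by (intro closed_segment_subset) (auto simp: convex_halfspace_gt)
        then show False using E(2) qb by auto
      qed
      define u where "u = (if v = r then s else r)"
      have u: "u \<noteq> v" "{r, s} = {v, u}" using rs(1) \<open>v \<in> {r, s}\<close> by (auto simp: u_def)
      have "poly_adj P v u" using u rs E E1 unfolding poly_adj_def by blast
      from c[OF this] have "E \<subseteq> {x. c \<bullet> x \<le> c \<bullet> v}" using u unfolding rs(2)
        by (intro closed_segment_subset) (auto simp: convex_halfspace_le doubleton_eq_iff)
      then show ?thesis using E(2) by auto
    qed
    \<comment> \<open>This is the parameter at which the segment from \<open>v\<close> to
      \<open>w\<close> crosses the hyperplane; the bound obtained there extends along the ray to
      \<open>w\<close>.\<close>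
    define t where "t = (b - a \<bullet> v) / (a \<bullet> w - a \<bullet> v)"
    have t: "0 < t" "t \<le> 1" "t * (a \<bullet> w - a \<bullet> v) = b - a \<bullet> v" using b(1) b(2)[of w] w False by (auto simp: t_def)
    have "(1 - t) *\<^sub>R v + t *\<^sub>R w \<in> P"
      using t v w poly_vertices_subset[of P] by (intro convexD_alt[OF polytope_imp_convex[OF P]]) auto
    then have "v + t *\<^sub>R (w - v) \<in> P" by (simp add: algebra_simps)
    moreover have "a \<bullet> (v + t *\<^sub>R (w - v)) = b" using t(3) by (simp add: inner_right_distrib inner_diff_right)
    ultimately have "c \<bullet> (v + t *\<^sub>R (w - v)) \<le> c \<bullet> v" using polytope_inner_le[OF pH ext] by blast
    then have "t * (c \<bullet> w - c \<bullet> v) \<le> 0" by (simp add: inner_right_distrib inner_diff_right)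
    then show ?thesis using t(1) by (simp add: mult_le_0_iff)
  qed simp
qed

lemma face_local_max:
  fixes P :: "'a::euclidean_space set"
  assumes P: "polytope P" and F: "F face_of P" and v: "v \<in> poly_vertices P" "v \<in> F"
    and c: "\<And>u. poly_adj P v u \<Longrightarrow> u \<in> F \<Longrightarrow> c \<bullet> u \<le> c \<bullet> v" and p: "p \<in> F"
  shows "c \<bullet> p \<le> c \<bullet> v"
  using vertex_local_max[OF face_of_polytope_polytope[OF P F], of v c p] v c p
  by (auto simp: poly_adj_face[OF P F] poly_vertices_face[OF F])

text \<open>A functional minimal on \<open>P\<close> exactly along \<open>G\<close> takes its value
  at \<open>v\<close> also at the neighbours of \<open>v\<close> in \<open>F\<close>. So
  \<open>v\<close> is a local and hence global maximum on \<open>F\<close> of a functional that is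
  minimal at \<open>v\<close>, and it is constant on \<open>F\<close>.\<close>

lemma face_subset_nbrs:
  fixes P :: "'a::euclidean_space set"
  assumes P: "polytope P" and F: "F face_of P" and G: "G face_of P" and v: "v \<in> poly_vertices P" "v \<in> F" "v \<in> G"
    and nb: "\<And>u. poly_adj P v u \<Longrightarrow> u \<in> F \<Longrightarrow> u \<in> G"
  shows "F \<subseteq> G"
proof
  fix p assume p: "p \<in> F"
  obtain a b where ab: "\<forall>p\<in>P. b \<le> a \<bullet> p" "G = P \<inter> {x. a \<bullet> x = b}" using face_exposing[OF P G] .
  have "a \<bullet> p \<le> a \<bullet> v" using ab nb v by (intro face_local_max[OF P F v(1,2) _ p]) auto
  then show "p \<in> G" using ab v p face_of_imp_subset[OF F] by (auto simp: order_antisym)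
qed

text \<open>Let \<open>z\<close> be the part of \<open>p - v\<close> orthogonal to all edge
  directions of \<open>F\<close> at \<open>v\<close>. As a functional it is constant on these edges,
  hence maximal at \<open>v\<close> on \<open>F\<close>; its value at \<open>p\<close> exceeds that
  at \<open>v\<close> by \<open>z \<bullet> z\<close>, so \<open>z\<close> vanishes.\<close>

lemma face_affine_hull_nbrs:
  fixes P :: "'a::euclidean_space set"
  assumes P: "polytope P" and F: "F face_of P" and v: "v \<in> poly_vertices P" "v \<in> F"
  shows "affine hull F = affine hull (insert v {u \<in> F. poly_adj P v u})"
proof -
  let ?N = "{u \<in> F. poly_adj P v u}"
  let ?D = "(\<lambda>u. u - v) ` ?N"
  have "p \<in> affine hull (insert v ?N)" if p: "p \<in> F" for p
  proof -
    obtain y z where yz: "y \<in> span ?D" "\<And>w. w \<in> span ?D \<Longrightarrow> orthogonal z w" "p - v = y + z"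
      using orthogonal_subspace_decomp_exists[of ?D "p - v"] by blast
    have "z \<bullet> u \<le> z \<bullet> v" if "u \<in> F" "poly_adj P v u" for u
      using yz(2)[of "u - v"] that by (auto simp: orthogonal_def inner_diff_right span_base)
    then have "z \<bullet> p \<le> z \<bullet> v" by (intro face_local_max[OF P F v _ p]) auto
    moreover have "z \<bullet> (p - v) = z \<bullet> z" using yz by (simp add: orthogonal_def inner_right_distrib)
    ultimately have "z \<bullet> z \<le> 0" by (simp add: inner_diff_right)
    then have "z = 0" by (metis inner_eq_zero_iff inner_ge_zero order_antisym)
    then have "p - v \<in> span ?D" using yz by simp
    moreover have "affine hull (insert v ?N) = (\<lambda>x. v + x) ` span ?D"
      using affine_hull_insert_span_gen[of v ?N] by simp
    ultimately show ?thesis by (auto simp: image_iff intro!: bexI[of _ "p - v"])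
  qed
  then have "affine hull F \<subseteq> affine hull (insert v ?N)" by (intro hull_minimal) (auto simp: affine_affine_hull)
  moreover have "affine hull (insert v ?N) \<subseteq> affine hull F" using v by (intro hull_mono) auto
  ultimately show ?thesis by simp
qed

section \<open>Degrees and simple vertices\<close>

lemma aff_dim_le_poly_degree:
  fixes P :: "'a::euclidean_space set"
  assumes P: "polytope P" and v: "v \<in> poly_vertices P"
  shows "aff_dim P \<le> int (poly_degree P v)"
proof -
  have vP: "v \<in> P" and fin: "finite {u. poly_adj P v u}"
    using v poly_vertices_subset finite_subset[OF _ finite_poly_vertices[OF P], of "{u. poly_adj P v u}"] by (auto dest: poly_adjD)
  have eq: "{u \<in> P. poly_adj P v u} = {u. poly_adj P v u}" using poly_vertices_subset by (auto dest: poly_adjD)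
  have "affine hull P = affine hull (insert v {u. poly_adj P v u})"
    using face_affine_hull_nbrs[OF P face_of_refl[OF polytope_imp_convex[OF P]] v vP] unfolding eq .
  then have "aff_dim P = aff_dim (insert v {u. poly_adj P v u})" by (metis aff_dim_affine_hull)
  also have "\<dots> \<le> int (card (insert v {u. poly_adj P v u})) - 1" using fin by (intro aff_dim_le_card) simp
  also have "\<dots> = int (poly_degree P v)"
    using fin by (simp add: poly_degree_def)
  finally show ?thesis .
qed

context
  fixes P :: "'a::euclidean_space set" and v
  assumes P: "polytope P" and v: "v \<in> poly_vertices P" and simple: "int (poly_degree P v) = aff_dim P"
begin

lemma simple_finite_nbrs: "finite {u. poly_adj P v u}"
  by (rule finite_subset[OF _ finite_poly_vertices[OF P]]) (auto dest: poly_adjD)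

text \<open>These \<open>poly_degree P v + 1\<close> points span an affine space of dimension
  \<open>poly_degree P v\<close>.\<close>

lemma simple_affine_independent: "\<not> affine_dependent (insert v {u. poly_adj P v u})"
proof -
  have vP: "v \<in> P" using v poly_vertices_subset by auto
  have eq: "{u \<in> P. poly_adj P v u} = {u. poly_adj P v u}" using poly_vertices_subset by (auto dest: poly_adjD)
  have "affine hull P = affine hull (insert v {u. poly_adj P v u})"
    using face_affine_hull_nbrs[OF P face_of_refl[OF polytope_imp_convex[OF P]] v vP] unfolding eq .
  then have "aff_dim P = aff_dim (insert v {u. poly_adj P v u})" by (metis aff_dim_affine_hull)
  moreover have "int (card (insert v {u. poly_adj P v u})) - 1 = int (poly_degree P v)"
    using simple_finite_nbrs by (simp add: poly_degree_def)
  ultimately show ?thesis using simple_finite_nbrs simple by (simp add: affine_independent_iff_card)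
qed

text \<open>The neighbours in \<open>F\<close> together with \<open>v\<close> span the affine hull
  of \<open>F\<close> and inherit independence. Their number is thus the same at all simple vertices
  of a face, which is \<open>deg_face\<close>.\<close>

lemma simple_face_aff_dim:
  assumes F: "F face_of P" "v \<in> F"
  shows "aff_dim F = int (card {u \<in> F. poly_adj P v u})"
proof -
  have "\<not> affine_dependent (insert v {u \<in> F. poly_adj P v u})"
    using simple_affine_independent by (rule affine_independent_subset) auto
  then have "aff_dim (insert v {u \<in> F. poly_adj P v u}) = int (card (insert v {u \<in> F. poly_adj P v u})) - 1"
    by (simp add: affine_independent_iff_card)
  also have "\<dots> = int (card {u \<in> F. poly_adj P v u})"
    using simple_finite_nbrs by (subst card_insert_disjoint) (auto dest: poly_adjD)
  finally show ?thesis using face_affine_hull_nbrs[OF P F(1) v F(2)] by (metis aff_dim_affine_hull)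
qed

text \<open>By independence of the edge directions a functional can be prescribed as 0 towards
  \<open>S\<close> and -1 towards the other neighbours. It is locally, hence globally, maximal at
  \<open>v\<close>, and the face it supports is the one wanted.\<close>

lemma simple_face_spanned:
  assumes S: "S \<subseteq> {u. poly_adj P v u}"
  obtains F where "F face_of P" "v \<in> F" "{u \<in> F. poly_adj P v u} = S"
proof -
  let ?N = "{u. poly_adj P v u}"
  have "v \<notin> ?N" by simp
  then have ind: "independent ((\<lambda>x. -v + x) ` ?N)"
    using simple_affine_independent affine_dependent_iff_dependent2[of v "insert v ?N"] by simp
  obtain g where g: "linear g" "\<forall>x\<in>(\<lambda>x. -v + x) ` ?N. g x = (if v + x \<in> S then 0 else -1 :: real)"
    using linear_independent_extend[OF ind, of "\<lambda>x. if v + x \<in> S then 0 else -1 :: real"] by (elim exE conjE)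
  \<comment> \<open>The adjoint turns the linear map \<open>g\<close> into the vector representing
    it.\<close>
  define c where "c = adjoint g 1"
  have c: "c \<bullet> x = g x" for x using adjoint_works[OF g(1), of x 1] by (simp add: c_def inner_commute)
  have cu: "c \<bullet> u - c \<bullet> v = (if u \<in> S then 0 else -1)" if "u \<in> ?N" for u
  proof -
    have "c \<bullet> u - c \<bullet> v = c \<bullet> (-v + u)" by (simp add: inner_diff_right)
    also have "\<dots> = (if v + (-v + u) \<in> S then 0 else -1)" unfolding c by (rule bspec[OF g(2) imageI[OF that]])
    finally show ?thesis by simp
  qed
  let ?F = "P \<inter> {x. c \<bullet> x = c \<bullet> v}"
  have "c \<bullet> u \<le> c \<bullet> v" if "poly_adj P v u" for u using cu[of u] that by (simp split: if_splits)
  then have "c \<bullet> p \<le> c \<bullet> v" if "p \<in> P" for p using vertex_local_max[OF P v _ that] by blast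
  then have "?F face_of P" by (rule face_of_Int_supporting_hyperplane_le[OF polytope_imp_convex[OF P]])
  moreover have "v \<in> ?F" using v poly_vertices_subset by auto
  moreover have "{u \<in> ?F. poly_adj P v u} = S"
  proof
    show "{u \<in> ?F. poly_adj P v u} \<subseteq> S"
    proof
      fix u assume u: "u \<in> {u \<in> ?F. poly_adj P v u}"
      then have "c \<bullet> u - c \<bullet> v = 0" by simp
      then show "u \<in> S" using cu[of u] u by (simp split: if_splits)
    qed
    show "S \<subseteq> {u \<in> ?F. poly_adj P v u}"
    proof
      fix u assume u: "u \<in> S"
      then have "u \<in> ?N" using S by auto
      moreover from this have "u \<in> P" using poly_adjD[of P v u] poly_vertices_subset[of P] by auto
      ultimately show "u \<in> {u \<in> ?F. poly_adj P v u}" using cu[of u] u by simp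
    qed
  qed
  ultimately show thesis by (rule that)
qed

end

section \<open>Heights from quotients of affine functionals\<close>

definition affine_functional :: "('a::euclidean_space \<Rightarrow> real) \<Rightarrow> bool" where
  "affine_functional \<alpha> \<longleftrightarrow> (\<exists>a s. \<forall>p. \<alpha> p = a \<bullet> p + s)"

lemma affine_functional_inner: "affine_functional (\<lambda>p. a \<bullet> p + s)"
  by (auto simp: affine_functional_def)

lemma affine_functional_const: "affine_functional (\<lambda>_. s)"
  using affine_functional_inner[of 0 s] by simp

lemma affine_functional_add:
  assumes "affine_functional \<alpha>" "affine_functional \<beta>" shows "affine_functional (\<lambda>p. \<alpha> p + \<beta> p)"
proof -
  obtain a s b t where "\<And>p. \<alpha> p = a \<bullet> p + s" "\<And>p. \<beta> p = b \<bullet> p + t"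
    using assms by (auto simp: affine_functional_def)
  then show ?thesis unfolding affine_functional_def
    by (intro exI[of _ "a + b"] exI[of _ "s + t"]) (simp add: inner_add_left)
qed

lemma affine_functional_scale:
  assumes "affine_functional \<alpha>" shows "affine_functional (\<lambda>p. k * \<alpha> p)"
proof -
  obtain a s where "\<And>p. \<alpha> p = a \<bullet> p + s"
    using assms by (auto simp: affine_functional_def)
  then show ?thesis unfolding affine_functional_def
    by (intro exI[of _ "k *\<^sub>R a"] exI[of _ "k * s"]) (simp add: distrib_left)
qed

lemma face_exposing_functional:
  assumes "polytope P" "F face_of P"
  obtains \<alpha> where "affine_functional \<alpha>" "\<And>p. p \<in> F \<Longrightarrow> \<alpha> p = 0" "\<And>p. p \<in> P - F \<Longrightarrow> 0 < \<alpha> p"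
proof -
  obtain a b where ab: "\<forall>p\<in>P. b \<le> a \<bullet> p" "F = P \<inter> {x. a \<bullet> x = b}" using face_exposing[OF assms] .
  show thesis
  proof (rule that[of "\<lambda>p. a \<bullet> p - b"])
    show "affine_functional (\<lambda>p. a \<bullet> p - b)" using affine_functional_inner[of a "-b"] by simp
    show "0 < a \<bullet> p - b" if "p \<in> P - F" for p using that ab by (force simp: order_less_le)
  qed (simp add: ab(2))
qed

section \<open>Small perturbations and general position\<close>

lemma finite_small_perturbation:
  fixes A B :: "'i \<Rightarrow> real"
  assumes "finite S"
  shows "\<exists>e>0. \<forall>i\<in>S. 0 < A i \<longrightarrow> 0 < A i + e * B i"
proof -
  \<comment> \<open>The induction needs the claim for all smaller \<open>d\<close>, so that the
    bounds for different indices combine by a minimum.\<close>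
  have "\<exists>e>0. \<forall>d. 0 < d \<and> d \<le> e \<longrightarrow> (\<forall>i\<in>S. 0 < A i \<longrightarrow> 0 < A i + d * B i)"
    using assms
  proof induction
    case empty
    show ?case by (rule exI[of _ 1]) simp
  next
    case (insert j S)
    from insert.IH obtain e where e: "e > 0" "\<forall>d. 0 < d \<and> d \<le> e \<longrightarrow> (\<forall>i\<in>S. 0 < A i \<longrightarrow> 0 < A i + d * B i)"
      by (elim exE conjE)
    \<comment> \<open>Dividing by \<open>\<bar>B j\<bar> + 1\<close> avoids a zero denominator and
      leaves the slack \<open>d\<close> that makes the inequality strict.\<close>
    define e' where "e' = (if 0 < A j then min e (A j / (\<bar>B j\<bar> + 1)) else e)"
    have j: "0 < A j + d * B j" if d: "0 < d" "d \<le> e'" "0 < A j" for d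
    proof -
      have "d \<le> A j / (\<bar>B j\<bar> + 1)" using d by (simp add: e'_def)
      moreover have "0 < \<bar>B j\<bar> + 1" by simp
      ultimately have "d * (\<bar>B j\<bar> + 1) \<le> A j" by (simp only: pos_le_divide_eq)
      moreover have "- (d * \<bar>B j\<bar>) \<le> d * B j"
        using mult_left_mono[of "- \<bar>B j\<bar>" "B j" d] d(1) by simp
      ultimately show ?thesis using d(1) by (simp add: distrib_left)
    qed
    have "0 < \<bar>B j\<bar> + 1" by simp
    then have e': "e' > 0" "e' \<le> e" using e(1) by (simp_all add: e'_def)
    show ?case
    proof (intro exI[of _ e'] conjI allI impI ballI)
      fix d i assume "0 < d \<and> d \<le> e'" "i \<in> insert j S" "0 < A i"
      moreover from this have "d \<le> e" using e'(2) by simp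
      ultimately show "0 < A i + d * B i" using j[of d] e(2)[rule_format, of d i] by (cases "i = j") simp_all
    qed (rule e')
  qed
  then show ?thesis by blast
qed

lemma finite_refine_order:
  fixes f g :: "'i \<Rightarrow> real"
  assumes "finite S"
  shows "\<exists>e>0. \<forall>p\<in>S. \<forall>q\<in>S. f p < f q \<longrightarrow> f p + e * g p < f q + e * g q"
proof -
  obtain e where e: "e > 0" "\<forall>i\<in>S \<times> S. 0 < f (snd i) - f (fst i) \<longrightarrow>
      0 < (f (snd i) - f (fst i)) + e * (g (snd i) - g (fst i))"
    using finite_small_perturbation[of "S \<times> S" "\<lambda>i. f (snd i) - f (fst i)" "\<lambda>i. g (snd i) - g (fst i)"] assms by auto
  have "f p + e * g p < f q + e * g q" if "p \<in> S" "q \<in> S" "f p < f q" for p q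
    using e(2)[rule_format, of "(p, q)"] that by (simp add: right_diff_distrib)
  then show ?thesis using e(1) by blast
qed

lemma finite_generic_vector:
  fixes Z :: "'a::euclidean_space set"
  assumes "finite Z" "0 \<notin> Z"
  shows "\<exists>c. \<forall>z\<in>Z. c \<bullet> z \<noteq> 0"
  using assms
proof induction
  case (insert w Z)
  then obtain c where c: "\<forall>z\<in>Z. c \<bullet> z \<noteq> 0" by auto
  show ?case
  proof (cases "c \<bullet> w = 0")
    case True
    \<comment> \<open>A small multiple of \<open>w\<close> repairs the zero at \<open>w\<close>,
      while the other inner products stay nonzero.\<close>
    obtain e where e: "e > 0" "\<forall>z\<in>Z. 0 < \<bar>c \<bullet> z\<bar> \<longrightarrow> 0 < \<bar>c \<bullet> z\<bar> + e * - \<bar>w \<bullet> z\<bar>"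
      using finite_small_perturbation[OF insert(1), of "\<lambda>z. \<bar>c \<bullet> z\<bar>" "\<lambda>z. - \<bar>w \<bullet> z\<bar>"] by blast
    have "(c + e *\<^sub>R w) \<bullet> z \<noteq> 0" if "z \<in> insert w Z" for z
    proof (cases "z = w")
      case True
      have "w \<bullet> w > 0" using insert.prems by auto
      then have "e * (w \<bullet> w) \<noteq> 0" using e(1) by simp
      moreover have "(c + e *\<^sub>R w) \<bullet> z = e * (w \<bullet> w)" using \<open>c \<bullet> w = 0\<close> True by (simp add: inner_add_left)
      ultimately show ?thesis by simp
    next
      case False
      then have "e * \<bar>w \<bullet> z\<bar> < \<bar>c \<bullet> z\<bar>" using e(2) c that by auto
      then have "\<bar>e * (w \<bullet> z)\<bar> < \<bar>c \<bullet> z\<bar>" using e(1) by (simp add: abs_mult)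
      moreover have "(c + e *\<^sub>R w) \<bullet> z = c \<bullet> z + e * (w \<bullet> z)" by (simp add: inner_add_left)
      ultimately show ?thesis by linarith
    qed
    then show ?thesis by blast
  next
    case False
    then show ?thesis using c by (intro exI[of _ c]) simp
  qed
qed simp

text \<open>An affine numerator is a vector \<open>(a, s)\<close> of the product space, and the
  difference of its ratios at \<open>p\<close> and \<open>q\<close> is the inner product with
  \<open>z p q\<close>. The second component of \<open>z p q\<close> vanishes only if the
  denominators agree, and then the first is a nonzero multiple of \<open>p - q\<close>.\<close>

lemma generic_ratio:
  fixes V :: "'a::euclidean_space set"
  assumes V: "finite V" and \<beta>: "\<And>p. p \<in> V \<Longrightarrow> 0 < \<beta> p"
  shows "\<exists>\<gamma>. affine_functional \<gamma> \<and> inj_on (\<lambda>p. \<gamma> p / \<beta> p) V"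
proof -
  define z where "z p q = ((1 / \<beta> p) *\<^sub>R p - (1 / \<beta> q) *\<^sub>R q, 1 / \<beta> p - 1 / \<beta> q)" for p q
  let ?Z = "(\<lambda>i. z (fst i) (snd i)) ` {i \<in> V \<times> V. fst i \<noteq> snd i}"
  have nz: "z p q \<noteq> 0" if pq: "p \<in> V" "q \<in> V" "p \<noteq> q" for p q
  proof
    assume "z p q = 0"
    then have "fst (z p q) = 0" "snd (z p q) = 0" by simp_all
    then have eq: "(1 / \<beta> p) *\<^sub>R p - (1 / \<beta> q) *\<^sub>R q = 0" "\<beta> p = \<beta> q" unfolding z_def by auto
    have "(1 / \<beta> q) *\<^sub>R (p - q) = 0" using eq(1) unfolding eq(2) by (simp only: scaleR_diff_right)
    then show False using \<beta>[OF pq(2)] pq(3) by simp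
  qed
  have "0 \<notin> ?Z"
  proof
    assume "0 \<in> ?Z"
    then obtain i where i: "0 = z (fst i) (snd i)" "i \<in> V \<times> V" "fst i \<noteq> snd i" by blast
    then show False using nz[of "fst i" "snd i"] by (simp add: mem_Times_iff)
  qed
  moreover have "finite ?Z" using V by simp
  ultimately obtain c where c: "\<forall>z\<in>?Z. c \<bullet> z \<noteq> 0" using finite_generic_vector[of ?Z] by blast
  define a s where as: "a = fst c" "s = snd c"
  have "inj_on (\<lambda>p. (a \<bullet> p + s) / \<beta> p) V"
  proof (rule inj_onI, rule ccontr)
    fix p q assume pq: "p \<in> V" "q \<in> V" and eq: "(a \<bullet> p + s) / \<beta> p = (a \<bullet> q + s) / \<beta> q" and ne: "p \<noteq> q"
    have "c \<bullet> z p q = (a \<bullet> p + s) / \<beta> p - (a \<bullet> q + s) / \<beta> q"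
      by (simp add: as z_def inner_prod_def inner_diff_right add_divide_distrib right_diff_distrib)
    then have "c \<bullet> z p q = 0" using eq by simp
    moreover have "z p q \<in> ?Z" using pq ne by (intro image_eqI[of _ _ "(p, q)"]) auto
    ultimately show False using c by blast
  qed
  then show ?thesis using affine_functional_inner by blast
qed

text \<open>At each vertex such an order agrees with that of a linear functional; this is the case for quotients of
  affine functionals with positive denominator.\<close>
definition poly_height :: "'a::euclidean_space set \<Rightarrow> ('a \<Rightarrow> real) \<Rightarrow> bool" where
  "poly_height P h \<longleftrightarrow> inj_on h (poly_vertices P) \<and>
     (\<forall>v\<in>poly_vertices P. \<exists>c. \<forall>p\<in>poly_vertices P. (h p < h v \<longleftrightarrow> c \<bullet> p < c \<bullet> v) \<and> (h v < h p \<longleftrightarrow> c \<bullet> v < c \<bullet> p))"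

text \<open>After clearing denominators, the comparison with the value at \<open>v\<close> is the
  sign of \<open>\<beta> v * \<alpha> p - \<alpha> v * \<beta> p\<close>, which is affine in
  \<open>p\<close> and vanishes at \<open>v\<close>; \<open>c\<close> is its linear part.\<close>

lemma poly_height_ratio:
  assumes \<alpha>: "affine_functional \<alpha>" and \<beta>: "affine_functional \<beta>" and pos: "\<And>p. p \<in> poly_vertices P \<Longrightarrow> 0 < \<beta> p"
    and inj: "inj_on (\<lambda>p. \<alpha> p / \<beta> p) (poly_vertices P)"
  shows "poly_height P (\<lambda>p. \<alpha> p / \<beta> p)"
  unfolding poly_height_def
proof (intro conjI inj ballI)
  fix v assume v: "v \<in> poly_vertices P"
  have "affine_functional (\<lambda>p. \<beta> v * \<alpha> p + (- \<alpha> v) * \<beta> p)"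
    by (intro affine_functional_add affine_functional_scale \<alpha> \<beta>)
  then obtain c s where c: "\<And>p. \<beta> v * \<alpha> p - \<alpha> v * \<beta> p = c \<bullet> p + s" by (auto simp: affine_functional_def)
  have cv: "c \<bullet> v + s = 0" using c[of v] by simp
  show "\<exists>c. \<forall>p\<in>poly_vertices P. (\<alpha> p / \<beta> p < \<alpha> v / \<beta> v \<longleftrightarrow> c \<bullet> p < c \<bullet> v) \<and>
      (\<alpha> v / \<beta> v < \<alpha> p / \<beta> p \<longleftrightarrow> c \<bullet> v < c \<bullet> p)"
  proof (intro exI[of _ c] ballI)
    fix p assume p: "p \<in> poly_vertices P"
    have "\<alpha> p / \<beta> p < \<alpha> v / \<beta> v \<longleftrightarrow> \<beta> v * \<alpha> p - \<alpha> v * \<beta> p < 0"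
      using pos[OF p] pos[OF v] by (simp add: divide_simps mult.commute)
    moreover have "\<alpha> v / \<beta> v < \<alpha> p / \<beta> p \<longleftrightarrow> \<beta> v * \<alpha> p - \<alpha> v * \<beta> p > 0"
      using pos[OF p] pos[OF v] by (simp add: divide_simps mult.commute)
    ultimately show "(\<alpha> p / \<beta> p < \<alpha> v / \<beta> v \<longleftrightarrow> c \<bullet> p < c \<bullet> v) \<and> (\<alpha> v / \<beta> v < \<alpha> p / \<beta> p \<longleftrightarrow> c \<bullet> v < c \<bullet> p)"
      using cv unfolding c by linarith
  qed
qed

text \<open>Two successive small perturbations of the numerator over a common denominator realise a
  lexicographic order: first \<open>\<alpha> / \<beta>\<close>, then
  \<open>\<gamma> / \<beta>\<close>, then a generic ratio that makes the height injective.\<close>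

lemma poly_height_lex:
  assumes P: "polytope P" and aff: "affine_functional \<alpha>" "affine_functional \<beta>" "affine_functional \<gamma>"
    and pos: "\<And>p. p \<in> poly_vertices P \<Longrightarrow> 0 < \<beta> p"
  obtains h where "poly_height P h"
    "\<And>p q. p \<in> poly_vertices P \<Longrightarrow> q \<in> poly_vertices P \<Longrightarrow> \<alpha> p / \<beta> p < \<alpha> q / \<beta> q \<Longrightarrow> h p < h q"
    "\<And>p q. p \<in> poly_vertices P \<Longrightarrow> q \<in> poly_vertices P \<Longrightarrow> \<alpha> p / \<beta> p = \<alpha> q / \<beta> q \<Longrightarrow>
        \<gamma> p / \<beta> p < \<gamma> q / \<beta> q \<Longrightarrow> h p < h q"
proof -
  note fin = finite_poly_vertices[OF P]
  obtain \<delta> where \<delta>: "affine_functional \<delta>" "inj_on (\<lambda>p. \<delta> p / \<beta> p) (poly_vertices P)"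
    using generic_ratio[of "poly_vertices P" \<beta>, OF fin pos] by blast
  obtain e where e: "e > 0" "\<forall>p\<in>poly_vertices P. \<forall>q\<in>poly_vertices P. \<alpha> p / \<beta> p < \<alpha> q / \<beta> q \<longrightarrow>
      \<alpha> p / \<beta> p + e * (\<gamma> p / \<beta> p) < \<alpha> q / \<beta> q + e * (\<gamma> q / \<beta> q)"
    using finite_refine_order[OF fin, of "\<lambda>p. \<alpha> p / \<beta> p" "\<lambda>p. \<gamma> p / \<beta> p"] by blast
  define f where "f p = \<alpha> p / \<beta> p + e * (\<gamma> p / \<beta> p)" for p
  obtain d where d: "d > 0" "\<forall>p\<in>poly_vertices P. \<forall>q\<in>poly_vertices P. f p < f q \<longrightarrow>
      f p + d * (\<delta> p / \<beta> p) < f q + d * (\<delta> q / \<beta> q)"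
    using finite_refine_order[OF fin, of f "\<lambda>p. \<delta> p / \<beta> p"] by blast
  define h where "h p = (\<alpha> p + (e * \<gamma> p + d * \<delta> p)) / \<beta> p" for p
  have h: "h p = f p + d * (\<delta> p / \<beta> p)" for p by (simp add: h_def f_def add_divide_distrib)
  have less: "h p < h q" if "p \<in> poly_vertices P" "q \<in> poly_vertices P" "f p < f q" for p q
    unfolding h using d(2) that by blast
  have "inj_on h (poly_vertices P)"
  proof (rule inj_onI)
    fix p q assume pq: "p \<in> poly_vertices P" "q \<in> poly_vertices P" and eq: "h p = h q"
    have "f p = f q" using less[OF pq] less[OF pq(2,1)] eq by (cases "f p" "f q" rule: linorder_cases) auto
    then have "d * (\<delta> p / \<beta> p) = d * (\<delta> q / \<beta> q)" using eq unfolding h by linarith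
    then have "\<delta> p / \<beta> p = \<delta> q / \<beta> q" using d(1) by (simp only: mult_cancel_left) simp
    then show "p = q" using inj_onD[OF \<delta>(2) _ pq] by simp
  qed
  then have "poly_height P h" unfolding h_def
    by (intro poly_height_ratio affine_functional_add affine_functional_scale aff \<delta>(1) pos)
  then show thesis
  proof (rule that)
    show "h p < h q" if "p \<in> poly_vertices P" "q \<in> poly_vertices P" "\<alpha> p / \<beta> p < \<alpha> q / \<beta> q" for p q
      using e(2) that by (intro less that(1,2)) (simp add: f_def)
    show "h p < h q" if "p \<in> poly_vertices P" "q \<in> poly_vertices P" "\<alpha> p / \<beta> p = \<alpha> q / \<beta> q"
        "\<gamma> p / \<beta> p < \<gamma> q / \<beta> q" for p q
    proof (rule less[OF that(1,2)])
      show "f p < f q" unfolding f_def that(3) using mult_strict_left_mono[OF that(4) e(1)] by simp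
    qed
  qed
qed



lemma polytope_vertex_exists: "polytope F \<Longrightarrow> F \<noteq> {} \<Longrightarrow> poly_vertices F \<noteq> {}"
  using polytope_hull_vertices[of F] by auto

section \<open>Heights adapted to a face and to prescribed vertices\<close>

lemma poly_height_initial:
  fixes P :: "'a::euclidean_space set"
  assumes P: "polytope P" and F: "F face_of P"
  obtains h where "poly_height P h" "initial (poly_vertices P) h (poly_vertices P \<inter> F)"
proof -
  obtain \<alpha> where \<alpha>: "affine_functional \<alpha>" "\<And>p. p \<in> F \<Longrightarrow> \<alpha> p = 0" "\<And>p. p \<in> P - F \<Longrightarrow> 0 < \<alpha> p"
    by (rule face_exposing_functional[OF P F]) blast
  obtain h where h: "poly_height P h"
    "\<And>p q. p \<in> poly_vertices P \<Longrightarrow> q \<in> poly_vertices P \<Longrightarrow> \<alpha> p / 1 < \<alpha> q / 1 \<Longrightarrow> h p < h q"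
    by (rule poly_height_lex[OF P \<alpha>(1) affine_functional_const[of 1] affine_functional_const[of 0]]) (simp, blast)
  have "u \<in> F" if "v \<in> poly_vertices P \<inter> F" "u \<in> poly_vertices P" "h u < h v" for u v
  proof (rule ccontr)
    assume "u \<notin> F"
    then have "u \<in> P - F" using that(2) poly_vertices_subset by auto
    then have "\<alpha> v / 1 < \<alpha> u / 1" using \<alpha>(2)[of v] \<alpha>(3)[of u] that(1) by simp
    then have "h v < h u" using h(2)[of v u] that by simp
    then show False using that(3) by simp
  qed
  then show thesis using that[OF h(1)] by (simp add: initial_def)
qed

text \<open>The ratio \<open>\<alpha> / (\<alpha> + \<tau>)\<close> is 0 on the vertices of
  \<open>F\<close> and reaches its largest value 1 at \<open>t\<close> alone, because
  \<open>\<tau>\<close> vanishes only there. Ties within \<open>F\<close> are resolved by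
  \<open>\<sigma>\<close> over the same denominator, which vanishes at \<open>s\<close>
  alone.\<close>

lemma poly_height_separating:
  fixes P :: "'a::euclidean_space set"
  assumes P: "polytope P" and F: "F face_of P" and s: "s \<in> poly_vertices P \<inter> F" and t: "t \<in> poly_vertices P - F"
  obtains h where "poly_height P h" "initial (poly_vertices P) h (poly_vertices P \<inter> F)"
    "\<forall>v\<in>poly_vertices P - {s}. h s < h v" "\<forall>v\<in>poly_vertices P - {t}. h v < h t"
proof -
  let ?V = "poly_vertices P"
  have VP: "v \<in> P" if "v \<in> ?V" for v using that poly_vertices_subset by auto
  obtain \<alpha> where \<alpha>: "affine_functional \<alpha>" "\<And>p. p \<in> F \<Longrightarrow> \<alpha> p = 0" "\<And>p. p \<in> P - F \<Longrightarrow> 0 < \<alpha> p"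
    by (rule face_exposing_functional[OF P F]) blast
  have fs: "{s} face_of P" and ft: "{t} face_of P" using s t by (auto simp: poly_vertices_def)
  obtain \<sigma> where \<sigma>: "affine_functional \<sigma>" "\<And>p. p \<in> {s} \<Longrightarrow> \<sigma> p = 0" "\<And>p. p \<in> P - {s} \<Longrightarrow> 0 < \<sigma> p"
    by (rule face_exposing_functional[OF P fs]) blast
  obtain \<tau> where \<tau>: "affine_functional \<tau>" "\<And>p. p \<in> {t} \<Longrightarrow> \<tau> p = 0" "\<And>p. p \<in> P - {t} \<Longrightarrow> 0 < \<tau> p"
    by (rule face_exposing_functional[OF P ft]) blast
  have \<tau>0: "0 \<le> \<tau> p" if "p \<in> P" for p using \<tau>(2,3)[of p] that by (cases "p = t") auto
  have \<alpha>0: "0 \<le> \<alpha> p" if "p \<in> P" for p using \<alpha>(2,3)[of p] that by (cases "p \<in> F") auto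
  have pos: "0 < \<alpha> p + \<tau> p" if "p \<in> ?V" for p
    using \<alpha>0[of p] \<tau>0[of p] \<alpha>(3)[of t] \<tau>(3)[of p] VP[OF that] t by (cases "p = t") auto
  obtain h where h: "poly_height P h"
    "\<And>p q. p \<in> ?V \<Longrightarrow> q \<in> ?V \<Longrightarrow> \<alpha> p / (\<alpha> p + \<tau> p) < \<alpha> q / (\<alpha> q + \<tau> q) \<Longrightarrow> h p < h q"
    "\<And>p q. p \<in> ?V \<Longrightarrow> q \<in> ?V \<Longrightarrow> \<alpha> p / (\<alpha> p + \<tau> p) = \<alpha> q / (\<alpha> q + \<tau> q) \<Longrightarrow>
        \<sigma> p / (\<alpha> p + \<tau> p) < \<sigma> q / (\<alpha> q + \<tau> q) \<Longrightarrow> h p < h q"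
    by (rule poly_height_lex[OF P \<alpha>(1) affine_functional_add[OF \<alpha>(1) \<tau>(1)] \<sigma>(1) pos]) blast+
  have above: "h v < h u" if "v \<in> ?V" "v \<in> F" "u \<in> ?V" "u \<notin> F" for u v
  proof (rule h(2)[OF that(1,3)])
    have "\<alpha> v = 0" "0 < \<alpha> u" using \<alpha>(2,3) that VP by auto
    then show "\<alpha> v / (\<alpha> v + \<tau> v) < \<alpha> u / (\<alpha> u + \<tau> u)" using pos[OF that(3)] by simp
  qed
  have ini: "initial ?V h (?V \<inter> F)"
    unfolding initial_def using above by (meson IntD1 IntD2 IntI order_less_asym)
  have smin: "h s < h v" if v: "v \<in> ?V - {s}" for v
  proof (cases "v \<in> F")
    case True
    show ?thesis
    proof (rule h(3))
      show "\<alpha> s / (\<alpha> s + \<tau> s) = \<alpha> v / (\<alpha> v + \<tau> v)" using \<alpha>(2) True s by simp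
      show "\<sigma> s / (\<alpha> s + \<tau> s) < \<sigma> v / (\<alpha> v + \<tau> v)" using \<sigma>(2)[of s] \<sigma>(3)[of v] v VP pos[of v] by simp
    qed (use s v in auto)
  next
    case False
    then show ?thesis using above[of s v] s v by auto
  qed
  have tmax: "h v < h t" if v: "v \<in> ?V - {t}" for v
  proof (rule h(2))
    have "\<alpha> t / (\<alpha> t + \<tau> t) = 1" using \<tau>(2)[of t] \<alpha>(3)[of t] t VP by simp
    moreover have "\<alpha> v / (\<alpha> v + \<tau> v) < 1" using \<tau>(3)[of v] v VP[of v] pos[of v] by simp
    ultimately show "\<alpha> v / (\<alpha> v + \<tau> v) < \<alpha> t / (\<alpha> t + \<tau> t)" by simp
  qed (use t v in auto)
  show thesis using that[OF h(1) ini] smin tmax by blast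
qed

text \<open>\<open>\<alpha>\<close> puts \<open>F\<close> first; inside \<open>F\<close>,
  \<open>\<epsilon>\<close> puts the edge from \<open>x\<close> to \<open>y\<close> first, and a
  small multiple of \<open>\<sigma>\<close> puts \<open>x\<close> before \<open>y\<close>.\<close>

lemma poly_height_adjacent:
  fixes P :: "'a::euclidean_space set"
  assumes P: "polytope P" and F: "F face_of P" and xy: "x \<in> F" "y \<in> F" "poly_adj P x y"
  obtains h where "poly_height P h" "initial (poly_vertices P) h (poly_vertices P \<inter> F)"
    "\<forall>v\<in>poly_vertices P - {x}. h x < h v" "\<forall>v\<in>poly_vertices P. h v < h y \<longrightarrow> v = x"
proof -
  let ?V = "poly_vertices P"
  have VP: "v \<in> P" if "v \<in> ?V" for v using that poly_vertices_subset by auto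
  have xyV: "x \<in> ?V" "y \<in> ?V" "x \<noteq> y" using poly_adjD[OF xy(3)] by auto
  obtain \<alpha> where \<alpha>: "affine_functional \<alpha>" "\<And>p. p \<in> F \<Longrightarrow> \<alpha> p = 0" "\<And>p. p \<in> P - F \<Longrightarrow> 0 < \<alpha> p"
    by (rule face_exposing_functional[OF P F]) blast
  have fx: "{x} face_of P" using xyV by (auto simp: poly_vertices_def)
  obtain \<sigma> where \<sigma>: "affine_functional \<sigma>" "\<And>p. p \<in> {x} \<Longrightarrow> \<sigma> p = 0" "\<And>p. p \<in> P - {x} \<Longrightarrow> 0 < \<sigma> p"
    by (rule face_exposing_functional[OF P fx]) blast
  let ?E = "closed_segment x y"
  note E = poly_adj_segment_face[OF P xy(3)]
  obtain \<epsilon> where \<epsilon>: "affine_functional \<epsilon>" "\<And>p. p \<in> ?E \<Longrightarrow> \<epsilon> p = 0" "\<And>p. p \<in> P - ?E \<Longrightarrow> 0 < \<epsilon> p"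
    by (rule face_exposing_functional[OF P E(1)]) blast
  obtain e where e: "e > 0" "\<forall>p\<in>?V. \<forall>q\<in>?V. \<epsilon> p < \<epsilon> q \<longrightarrow> \<epsilon> p + e * \<sigma> p < \<epsilon> q + e * \<sigma> q"
    using finite_refine_order[OF finite_poly_vertices[OF P], of \<epsilon> \<sigma>] by blast
  obtain h where h: "poly_height P h"
    "\<And>p q. p \<in> ?V \<Longrightarrow> q \<in> ?V \<Longrightarrow> \<alpha> p / 1 < \<alpha> q / 1 \<Longrightarrow> h p < h q"
    "\<And>p q. p \<in> ?V \<Longrightarrow> q \<in> ?V \<Longrightarrow> \<alpha> p / 1 = \<alpha> q / 1 \<Longrightarrow>
        (\<epsilon> p + e * \<sigma> p) / 1 < (\<epsilon> q + e * \<sigma> q) / 1 \<Longrightarrow> h p < h q"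
    by (rule poly_height_lex[OF P \<alpha>(1) affine_functional_const[of 1]
        affine_functional_add[OF \<epsilon>(1) affine_functional_scale[OF \<sigma>(1), of e]]]) (simp, blast)
  have above: "h v < h u" if "v \<in> ?V" "v \<in> F" "u \<in> ?V" "u \<notin> F" for u v
    using \<alpha>(2)[of v] \<alpha>(3)[of u] that VP by (intro h(2)) auto
  have ini: "initial ?V h (?V \<inter> F)"
    unfolding initial_def using above by (meson IntD1 IntD2 IntI order_less_asym)
  have xlty: "h x < h y"
  proof (rule h(3))
    show "\<alpha> x / 1 = \<alpha> y / 1" using \<alpha>(2) xy by simp
    have "0 < \<sigma> y" using \<sigma>(3)[of y] VP xyV by simp
    then show "(\<epsilon> x + e * \<sigma> x) / 1 < (\<epsilon> y + e * \<sigma> y) / 1" using \<sigma>(2)[of x] \<epsilon>(2)[of x] \<epsilon>(2)[of y] e(1) by simp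
  qed (use xyV in auto)
  have others: "h y < h v" if v: "v \<in> ?V - {x, y}" for v
  proof (cases "v \<in> F")
    case True
    have "v \<notin> ?E" using v E(2) by auto
    then have "0 < \<epsilon> v" using \<epsilon>(3)[of v] VP v by auto
    then have "\<epsilon> y < \<epsilon> v" using \<epsilon>(2)[of y] by simp
    then have "\<epsilon> y + e * \<sigma> y < \<epsilon> v + e * \<sigma> v" using e(2) xyV v by blast
    then show ?thesis using \<alpha>(2)[of v] \<alpha>(2)[of y] True xy xyV v by (intro h(3)) auto
  next
    case False
    then show ?thesis using above[of y v] xy xyV v by auto
  qed
  have xmin: "h x < h v" if v: "v \<in> ?V - {x}" for v
  proof (cases "v = y")
    case False
    then have "h y < h v" using others[of v] v by blast
    then show ?thesis using xlty by simp
  qed (simp add: xlty)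
  have ylow: "v = x" if v: "v \<in> ?V" "h v < h y" for v
  proof (rule ccontr)
    assume "v \<noteq> x"
    then have "v \<in> ?V - {x, y}" using v by auto
    then show False using others[of v] v(2) by simp
  qed
  show thesis using that[OF h(1) ini] xmin ylow by blast
qed

text \<open>On a common line, functionals strictly minimal at \<open>x\<close> and at
  \<open>y\<close> force \<open>0 < t\<close> and \<open>t < 1\<close>, so \<open>p\<close> would
  lie strictly between \<open>x\<close> and \<open>y\<close>. A functional strictly minimal at
  \<open>p\<close> forbids this.\<close>

lemma vertices_not_collinear:
  fixes P :: "'a::euclidean_space set"
  assumes P: "polytope P" and V: "x \<in> poly_vertices P" "y \<in> poly_vertices P" "p \<in> poly_vertices P"
    and ne: "p \<noteq> x" "p \<noteq> y" "x \<noteq> y"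
  shows "p - x \<noteq> t *\<^sub>R (y - x)"
proof
  assume eq: "p - x = t *\<^sub>R (y - x)"
  have inner: "a \<bullet> p = (1 - t) * (a \<bullet> x) + t * (a \<bullet> y)" for a
  proof -
    have "a \<bullet> (p - x) = t * (a \<bullet> (y - x))" unfolding eq by simp
    then show ?thesis by (simp add: inner_diff_right algebra_simps)
  qed
  obtain a where a: "a \<bullet> x < a \<bullet> p" "a \<bullet> x < a \<bullet> y" using vertex_exposing[OF P V(1)] V ne by auto
  obtain b where b: "b \<bullet> y < b \<bullet> p" "b \<bullet> y < b \<bullet> x" using vertex_exposing[OF P V(2)] V ne by auto
  obtain c where c: "c \<bullet> p < c \<bullet> x" "c \<bullet> p < c \<bullet> y" using vertex_exposing[OF P V(3)] V ne by auto
  have "0 < t * (a \<bullet> y - a \<bullet> x)" using a inner[of a] by (simp add: algebra_simps)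
  then have t: "0 < t" using a(2) by (simp add: zero_less_mult_iff)
  have "0 < (1 - t) * (b \<bullet> x - b \<bullet> y)" using b inner[of b] by (simp add: algebra_simps)
  then have t1: "0 < 1 - t" using b(2) by (simp add: zero_less_mult_iff)
  have "0 = (1 - t) * (c \<bullet> x - c \<bullet> p) + t * (c \<bullet> y - c \<bullet> p)" using inner[of c] by (simp add: algebra_simps)
  moreover have "0 < (1 - t) * (c \<bullet> x - c \<bullet> p)" "0 < t * (c \<bullet> y - c \<bullet> p)" using t t1 c by simp_all
  ultimately show False by linarith
qed

text \<open>A generic vector is projected onto the orthogonal complement of \<open>y - x\<close>. By
  \<open>vertices_not_collinear\<close> the projections of the differences \<open>p - x\<close> are
  nonzero, so genericity can be required of them.\<close>

lemma generic_hyperplane: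
  fixes P :: "'a::euclidean_space set"
  assumes P: "polytope P" and V: "x \<in> poly_vertices P" "y \<in> poly_vertices P" "x \<noteq> y"
  obtains c where "c \<bullet> x = c \<bullet> y" "\<And>p. p \<in> poly_vertices P - {x, y} \<Longrightarrow> c \<bullet> p \<noteq> c \<bullet> x"
proof -
  define w where "w = y - x"
  have w: "w \<bullet> w \<noteq> 0" using V(3) by (simp add: w_def)
  define pr where "pr u = u - ((u \<bullet> w) / (w \<bullet> w)) *\<^sub>R w" for u
  let ?Z = "(\<lambda>p. pr (p - x)) ` (poly_vertices P - {x, y})"
  have "pr (p - x) \<noteq> 0" if p: "p \<in> poly_vertices P - {x, y}" for p
    using vertices_not_collinear[OF P V(1,2) _ _ _ V(3), of p "((p - x) \<bullet> w) / (w \<bullet> w)"] p by (auto simp: pr_def w_def)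
  then have "0 \<notin> ?Z" by fastforce
  moreover have "finite ?Z" using finite_poly_vertices[OF P] by simp
  ultimately obtain c0 where c0: "\<forall>z\<in>?Z. c0 \<bullet> z \<noteq> 0" using finite_generic_vector[of ?Z] by blast
  \<comment> \<open>The orthogonal projection is self-adjoint.\<close>
  have sym: "pr c0 \<bullet> u = c0 \<bullet> pr u" for u by (simp add: pr_def inner_diff_left inner_diff_right inner_commute mult.commute)
  show thesis
  proof (rule that[of "pr c0"])
    have "pr c0 \<bullet> w = 0" using w by (simp add: pr_def inner_diff_left)
    then show "pr c0 \<bullet> x = pr c0 \<bullet> y" by (simp add: w_def inner_diff_right)
    show "pr c0 \<bullet> p \<noteq> pr c0 \<bullet> x" if p: "p \<in> poly_vertices P - {x, y}" for p
    proof -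
      have "pr c0 \<bullet> (p - x) \<noteq> 0" unfolding sym using c0 p by blast
      then show ?thesis by (simp add: inner_diff_right)
    qed
  qed
qed

text \<open>Tilt the hyperplane \<open>c \<bullet> p = c \<bullet> y\<close> so that \<open>x\<close> falls strictly below it, and take it as the level at \<open>y\<close> of
  a quotient vanishing only at \<open>x\<close>.\<close>
lemma poly_height_tilted:
  fixes P :: "'a::euclidean_space set"
  assumes P: "polytope P" and F: "F face_of P" and xy: "x \<in> poly_vertices P \<inter> F" "y \<in> poly_vertices P \<inter> F" "x \<noteq> y"
    and c: "c \<bullet> x = c \<bullet> y" "\<And>p. p \<in> poly_vertices P - {x, y} \<Longrightarrow> c \<bullet> p \<noteq> c \<bullet> x"
  obtains h where "poly_height P h" "initial (poly_vertices P) h (poly_vertices P \<inter> F)"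
    "\<forall>v\<in>poly_vertices P - {x}. h x < h v"
    "\<And>u. u \<in> poly_vertices P - {x, y} \<Longrightarrow> h u < h y \<Longrightarrow> c \<bullet> u < c \<bullet> x"
proof -
  let ?V = "poly_vertices P"
  have VP: "v \<in> P" if "v \<in> ?V" for v using that poly_vertices_subset by auto
  note fin = finite_poly_vertices[OF P]
  obtain \<alpha> where \<alpha>: "affine_functional \<alpha>" "\<And>p. p \<in> F \<Longrightarrow> \<alpha> p = 0" "\<And>p. p \<in> P - F \<Longrightarrow> 0 < \<alpha> p"
    by (rule face_exposing_functional[OF P F]) blast
  have fx: "{x} face_of P" using xy by (auto simp: poly_vertices_def)
  obtain \<sigma>0 where \<sigma>0: "affine_functional \<sigma>0" "\<And>p. p \<in> {x} \<Longrightarrow> \<sigma>0 p = 0" "\<And>p. p \<in> P - {x} \<Longrightarrow> 0 < \<sigma>0 p"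
    by (rule face_exposing_functional[OF P fx]) blast
  define \<sigma> where "\<sigma> p = (1 / \<sigma>0 y) * \<sigma>0 p" for p
  have s0y: "0 < \<sigma>0 y" using \<sigma>0(3)[of y] xy VP by auto
  have \<sigma>: "affine_functional \<sigma>" "\<sigma> x = 0" "\<sigma> y = 1" "\<And>p. p \<in> ?V - {x} \<Longrightarrow> 0 < \<sigma> p"
  proof -
    show "affine_functional \<sigma>" unfolding \<sigma>_def by (rule affine_functional_scale[OF \<sigma>0(1)])
    show "0 < \<sigma> p" if "p \<in> ?V - {x}" for p using \<sigma>0(3)[of p] that VP s0y by (simp add: \<sigma>_def)
  qed (use \<sigma>0(2)[of x] s0y in \<open>simp_all add: \<sigma>_def\<close>)
  \<comment> \<open>This is the coordinate along the line through \<open>x\<close> and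
    \<open>y\<close>; a small multiple of it tilts the hyperplane \<open>l = 0\<close> while keeping
    \<open>y\<close> on it.\<close>
  define \<kappa> where "\<kappa> p = (1 / ((x - y) \<bullet> (x - y))) * ((x - y) \<bullet> p + (- ((x - y) \<bullet> y)))" for p
  have \<kappa>: "affine_functional \<kappa>" "\<kappa> x = 1" "\<kappa> y = 0"
  proof -
    show "affine_functional \<kappa>" unfolding \<kappa>_def by (intro affine_functional_scale affine_functional_inner)
    have "(x - y) \<bullet> (x - y) \<noteq> 0" using xy(3) by simp
    moreover have "(x - y) \<bullet> x + (- ((x - y) \<bullet> y)) = (x - y) \<bullet> (x - y)" by (simp add: inner_diff_right)
    ultimately show "\<kappa> x = 1" unfolding \<kappa>_def by simp
  qed (simp add: \<kappa>_def)
  define l where "l p = c \<bullet> p + (- (c \<bullet> x))" for p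
  have l: "affine_functional l" "l x = 0" "l y = 0" "\<And>p. p \<in> ?V - {x, y} \<Longrightarrow> l p \<noteq> 0"
    using c affine_functional_inner[of c "- (c \<bullet> x)"] by (auto simp: l_def[abs_def])
  obtain d where d: "d > 0" "\<forall>p\<in>?V. 0 < \<bar>l p\<bar> \<longrightarrow> 0 < \<bar>l p\<bar> + d * - \<bar>\<kappa> p\<bar>"
    using finite_small_perturbation[OF fin, of "\<lambda>p. \<bar>l p\<bar>" "\<lambda>p. - \<bar>\<kappa> p\<bar>"] by blast
  \<comment> \<open>The tilted functional is positive at \<open>x\<close>, zero at \<open>y\<close>
    and, by the choice of \<open>d\<close>, of sign opposite to \<open>l\<close> at all other
    vertices.\<close>
  define m where "m p = (-1) * l p + d * \<kappa> p" for p
  have "affine_functional m"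
    unfolding m_def by (intro affine_functional_add affine_functional_scale \<kappa>(1) l(1))
  then have m: "affine_functional m" "m x = d" "m y = 0"
    using \<kappa> l by (simp_all add: m_def)
  have m_sign: "0 < m p \<longleftrightarrow> l p < 0" if p: "p \<in> ?V - {x, y}" for p
  proof -
    have "d * \<bar>\<kappa> p\<bar> < \<bar>l p\<bar>" using d(2) l(4)[OF p] p by auto
    then have "\<bar>d * \<kappa> p\<bar> < \<bar>l p\<bar>" using d(1) by (simp add: abs_mult)
    then show ?thesis unfolding m_def by (cases "l p < 0") auto
  qed
  obtain e where e: "e > 0" "\<forall>p\<in>?V. 0 < \<sigma> p \<longrightarrow> 0 < \<sigma> p + e * m p"
    using finite_small_perturbation[OF fin, of \<sigma> m] by blast
  \<comment> \<open>Where \<open>\<sigma>\<close> is positive, \<open>\<sigma> / \<beta> < 1\<close>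
    holds exactly when \<open>0 < m\<close>, and the ratio is 1 at \<open>y\<close>. On
    \<open>F\<close>, where \<open>\<alpha>\<close> vanishes, the tie-breaker thus has the tilted
    hyperplane as its level at \<open>y\<close>. At \<open>x\<close>, where \<open>\<sigma>\<close>
    vanishes, \<open>m x = d\<close> keeps the denominator positive.\<close>
  define \<beta> where "\<beta> p = \<sigma> p + e * m p" for p
  have pos: "0 < \<beta> p" if "p \<in> ?V" for p
  proof (cases "p = x")
    case True
    then show ?thesis using e(1) d(1) \<sigma>(2) m(2) by (simp add: \<beta>_def)
  next
    case False
    then show ?thesis using e(2) \<sigma>(4)[of p] that by (simp add: \<beta>_def)
  qed
  have aff\<beta>: "affine_functional \<beta>" unfolding \<beta>_def[abs_def] by (intro affine_functional_add affine_functional_scale \<sigma>(1) m(1))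
  obtain h where h: "poly_height P h"
    "\<And>p q. p \<in> ?V \<Longrightarrow> q \<in> ?V \<Longrightarrow> \<alpha> p / \<beta> p < \<alpha> q / \<beta> q \<Longrightarrow> h p < h q"
    "\<And>p q. p \<in> ?V \<Longrightarrow> q \<in> ?V \<Longrightarrow> \<alpha> p / \<beta> p = \<alpha> q / \<beta> q \<Longrightarrow> \<sigma> p / \<beta> p < \<sigma> q / \<beta> q \<Longrightarrow> h p < h q"
    by (rule poly_height_lex[OF P \<alpha>(1) aff\<beta> \<sigma>(1) pos]) blast+
  have above: "h v < h u" if "v \<in> ?V" "v \<in> F" "u \<in> ?V" "u \<notin> F" for u v
    using \<alpha>(2)[of v] \<alpha>(3)[of u] that VP pos by (intro h(2)) auto
  have ini: "initial ?V h (?V \<inter> F)"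
    unfolding initial_def using above by (meson IntD1 IntD2 IntI order_less_asym)
  have xmin: "h x < h v" if v: "v \<in> ?V - {x}" for v
  proof (cases "v \<in> F")
    case True
    show ?thesis
    proof (rule h(3))
      show "\<alpha> x / \<beta> x = \<alpha> v / \<beta> v" using \<alpha>(2) True xy by simp
      show "\<sigma> x / \<beta> x < \<sigma> v / \<beta> v" using \<sigma>(2) \<sigma>(4)[OF v] pos[of v] v by simp
    qed (use xy v in auto)
  next
    case False
    then show ?thesis using above[of x v] xy v by auto
  qed
  have low: "c \<bullet> u < c \<bullet> x" if u: "u \<in> ?V - {x, y}" "h u < h y" for u
  proof (rule ccontr)
    assume n: "\<not> c \<bullet> u < c \<bullet> x"
    have uF: "u \<in> F" using above[of y u] u xy by force
    have "\<not> 0 < m u" using m_sign[OF u(1)] n by (simp add: l_def)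
    moreover have "m u \<noteq> 0"
    proof
      assume "m u = 0"
      then have "l u = d * \<kappa> u" by (simp add: m_def)
      then have "\<bar>l u\<bar> = d * \<bar>\<kappa> u\<bar>" using d(1) by (simp add: abs_mult)
      then show False using d(2) l(4)[OF u(1)] u(1) by auto
    qed
    ultimately have "\<beta> u < \<sigma> u" using e(1) by (simp add: \<beta>_def mult_less_0_iff)
    then have "\<sigma> y / \<beta> y < \<sigma> u / \<beta> u" using pos[of u] u \<sigma>(3) m(3) by (simp add: \<beta>_def less_divide_eq)
    then have "h y < h u" using \<alpha>(2)[OF uF] \<alpha>(2)[of y] u xy by (intro h(3)) auto
    then show False using u(2) by simp
  qed
  show thesis using that[OF h(1) ini _ low] xmin by blast
qed

section \<open>The face system of a polytope with labelled vertices\<close>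

text \<open>Labels let two polytopes share one vertex set. The empty face is left out because it has
  no sink, whereas \<open>face_system\<close> is about nonempty faces.\<close>

definition labelled_faces :: "('v \<Rightarrow> 'a::euclidean_space) \<Rightarrow> 'v set \<Rightarrow> 'a set \<Rightarrow> 'v set set" where
  "labelled_faces e V P = {{v \<in> V. e v \<in> F} | F. F face_of P \<and> F \<noteq> {}}"

lemma face_eq_hull_vertices: "polytope P \<Longrightarrow> F face_of P \<Longrightarrow> convex hull (poly_vertices P \<inter> F) = F"
  using polytope_hull_vertices[OF face_of_polytope_polytope] poly_vertices_face by metis

text \<open>A face is the hull of its vertices, so passing to labels loses no information.\<close>

lemma labelled_face_hull:
  assumes "polytope P" "bij_betw e V (poly_vertices P)" "F face_of P"
  shows "convex hull (e ` {v \<in> V. e v \<in> F}) = F"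
proof -
  have "e ` {v \<in> V. e v \<in> F} = poly_vertices P \<inter> F" using assms(2) by (auto simp: bij_betw_def)
  then show ?thesis using face_eq_hull_vertices[OF assms(1,3)] by simp
qed

section \<open>The assumptions of a face system, verified for a labelled polytope\<close>

context
  fixes P :: "'a::euclidean_space set" and V :: "'v set" and e adj
  assumes P: "polytope P" and e: "bij_betw e V (poly_vertices P)"
    and adj: "\<And>u v. adj u v \<longleftrightarrow> u \<in> V \<and> v \<in> V \<and> poly_adj P (e u) (e v)"
begin

lemma label_vertex: "v \<in> V \<Longrightarrow> e v \<in> poly_vertices P"
  using e by (auto simp: bij_betw_def)

lemma label_inj: "u \<in> V \<Longrightarrow> v \<in> V \<Longrightarrow> e u = e v \<longleftrightarrow> u = v"
  using e by (auto simp: bij_betw_def inj_on_def)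

lemma label_obtain:
  assumes "p \<in> poly_vertices P" obtains v where "v \<in> V" "e v = p"
proof -
  have "p \<in> e ` V" using assms e by (simp add: bij_betw_def)
  then show thesis using that by blast
qed

text \<open>Relative to a given vertex, \<open>h\<close> is ordered like a linear functional
  \<open>c\<close>, so by \<open>face_local_max\<close> a sink of a face is a maximum of
  \<open>c\<close>, and hence of \<open>h\<close>, over the vertices of that face. Injectivity
  leaves only one.\<close>

lemma labelled_height:
  assumes h: "poly_height P h"
  shows "height V adj (labelled_faces e V P) (h \<circ> e)"
  unfolding height_def unique_sinks_def
proof (intro conjI ballI)
  have inj: "inj_on h (poly_vertices P)" using h by (simp add: poly_height_def)
  then show "inj_on (h \<circ> e) V" using e by (auto simp: bij_betw_def intro: comp_inj_on)
  fix W assume "W \<in> labelled_faces e V P"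
  then obtain F where F: "F face_of P" "F \<noteq> {}" and W: "W = {v \<in> V. e v \<in> F}" by (auto simp: labelled_faces_def)
  have "poly_vertices F \<noteq> {}" using polytope_vertex_exists[OF face_of_polytope_polytope[OF P F(1)] F(2)] .
  then obtain p where "p \<in> poly_vertices P" "p \<in> F" using poly_vertices_face[OF F(1)] by auto
  then have "W \<noteq> {}" unfolding W by (auto elim: label_obtain)
  moreover have "finite V" using bij_betw_finite[OF e] finite_poly_vertices[OF P] by simp
  then have "finite W" unfolding W by simp
  ultimately obtain m where m: "m \<in> W" "\<And>u. u \<in> W \<Longrightarrow> (h \<circ> e) u \<le> (h \<circ> e) m"
    using finite_maximizer[of W "h \<circ> e"] by blast
  have "m \<in> sinks adj (h \<circ> e) W"
  proof -
    have "h (e u) < h (e m)" if "u \<in> W" "adj m u" for u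
    proof -
      have "e u \<noteq> e m" using that(2) by (auto simp: adj)
      then have "h (e u) \<noteq> h (e m)" using inj_onD[OF inj] label_vertex that(1) m(1) W by blast
      then show ?thesis using m(2)[OF that(1)] by simp
    qed
    then show ?thesis using m(1) by (simp add: sinks_def)
  qed
  moreover have "v = m" if v: "v \<in> sinks adj (h \<circ> e) W" for v
  proof -
    have vW: "v \<in> V" "e v \<in> F" and vs: "\<And>u. u \<in> W \<Longrightarrow> adj v u \<Longrightarrow> h (e u) < h (e v)"
      using v by (auto simp: sinks_def W)
    obtain c where c: "\<forall>p\<in>poly_vertices P. (h p < h (e v) \<longleftrightarrow> c \<bullet> p < c \<bullet> e v) \<and> (h (e v) < h p \<longleftrightarrow> c \<bullet> e v < c \<bullet> p)"
      using h label_vertex[OF vW(1)] unfolding poly_height_def by blast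
    have "c \<bullet> p \<le> c \<bullet> e v" if p: "poly_adj P (e v) p" "p \<in> F" for p
    proof -
      obtain u where u: "u \<in> V" "e u = p" using poly_adjD[OF p(1)] by (auto elim: label_obtain)
      then have "h p < h (e v)" using vs[of u] p vW by (auto simp: W adj)
      then have "c \<bullet> p < c \<bullet> e v" using c poly_adjD[OF p(1)] by blast
      then show ?thesis by simp
    qed
    then have "c \<bullet> e m \<le> c \<bullet> e v"
      using face_local_max[OF P F(1) label_vertex[OF vW(1)] vW(2), of c "e m"] m(1) W by blast
    then have "\<not> h (e v) < h (e m)" using c label_vertex m(1) W by fastforce
    then have "h (e v) = h (e m)" using m(2)[of v] vW W by simp
    then have "e v = e m" using inj_onD[OF inj] label_vertex vW m(1) W by blast
    then show "v = m" using label_inj vW m(1) W by blast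
  qed
  ultimately have "sinks adj (h \<circ> e) W = {m}" by blast
  then show "card (sinks adj (h \<circ> e) W) = 1" by simp
qed

lemma labelled_initial:
  assumes "initial (poly_vertices P) h (poly_vertices P \<inter> F)"
  shows "initial V (h \<circ> e) {v \<in> V. e v \<in> F}"
  using assms label_vertex by (fastforce simp: initial_def)

lemma labelled_ball:
  assumes "\<forall>p\<in>poly_vertices P - {e s}. Q p" "s \<in> V"
  shows "\<forall>v\<in>V - {s}. Q (e v)"
  using assms label_vertex label_inj by blast

lemma labelled_height_separating:
  assumes F: "F face_of P" and s: "s \<in> V" "e s \<in> F" and t: "t \<in> V" "e t \<notin> F"
  shows "\<exists>h. height V adj (labelled_faces e V P) h \<and> initial V h {v \<in> V. e v \<in> F} \<and>
    (\<forall>v\<in>V-{s}. h s < h v) \<and> (\<forall>v\<in>V-{t}. h v < h t)"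
proof -
  have st: "e s \<in> poly_vertices P \<inter> F" "e t \<in> poly_vertices P - F" using s t label_vertex by auto
  obtain h where h: "poly_height P h" "initial (poly_vertices P) h (poly_vertices P \<inter> F)"
    "\<forall>v\<in>poly_vertices P - {e s}. h (e s) < h v" "\<forall>v\<in>poly_vertices P - {e t}. h v < h (e t)"
    using poly_height_separating[OF P F st] .
  show ?thesis
    using labelled_height[OF h(1)] labelled_initial[OF h(2)] labelled_ball[OF h(3) s(1)] labelled_ball[OF h(4) t(1)]
    by (intro exI[of _ "h \<circ> e"]) simp
qed

lemma labelled_height_adjacent:
  assumes F: "F face_of P" and x: "e x \<in> F" and y: "e y \<in> F" and a: "adj x y"
  shows "\<exists>h. height V adj (labelled_faces e V P) h \<and> initial V h {v \<in> V. e v \<in> F} \<and>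
    (\<forall>v\<in>V-{x}. h x < h v) \<and> (\<forall>v\<in>V. h v < h y \<longrightarrow> v = x)"
proof -
  have xV: "x \<in> V" and pa: "poly_adj P (e x) (e y)" using a by (simp_all add: adj)
  obtain h where h: "poly_height P h" "initial (poly_vertices P) h (poly_vertices P \<inter> F)"
    "\<forall>v\<in>poly_vertices P - {e x}. h (e x) < h v" "\<forall>v\<in>poly_vertices P. h v < h (e y) \<longrightarrow> v = e x"
    using poly_height_adjacent[OF P F x y pa] .
  have "\<forall>v\<in>V. h (e v) < h (e y) \<longrightarrow> v = x" using h(4) label_vertex label_inj xV by blast
  then show ?thesis
    using labelled_height[OF h(1)] labelled_initial[OF h(2)] labelled_ball[OF h(3) xV]
    by (intro exI[of _ "h \<circ> e"]) simp
qed

text \<open>Tilting with \<open>c\<close> and with \<open>-c\<close> puts the lower neighbours of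
  \<open>y\<close> on opposite sides of one hyperplane, so the two sets are disjoint. If
  \<open>y\<close> were a sink for one height of a face through \<open>x\<close>, none of its
  neighbours in that face would be lower for the other height; for that one \<open>y\<close> would
  be a local and hence global minimum on the face, although \<open>x\<close> is lower.\<close>

lemma labelled_height_nonadjacent:
  assumes F: "F face_of P" and x: "x \<in> V" "e x \<in> F" and y: "y \<in> V" "e y \<in> F" and xy: "x \<noteq> y" and a: "\<not> adj x y"
  shows "\<exists>h1 h2. (\<forall>h\<in>{h1, h2}. height V adj (labelled_faces e V P) h \<and> initial V h {v \<in> V. e v \<in> F} \<and>
        (\<forall>v\<in>V-{x}. h x < h v) \<and> (\<forall>W\<in>labelled_faces e V P. x \<in> W \<longrightarrow> y \<notin> sinks adj h W)) \<and>
      (\<forall>u. adj y u \<longrightarrow> \<not> (h1 u < h1 y \<and> h2 u < h2 y))"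
proof -
  let ?P = "poly_vertices P"
  have V: "e x \<in> ?P" "e y \<in> ?P" "e x \<noteq> e y" using x y xy label_vertex label_inj by auto
  have VF: "e x \<in> ?P \<inter> F" "e y \<in> ?P \<inter> F" using V x y by auto
  obtain c where c: "c \<bullet> e x = c \<bullet> e y" "\<And>p. p \<in> ?P - {e x, e y} \<Longrightarrow> c \<bullet> p \<noteq> c \<bullet> e x"
    by (rule generic_hyperplane[OF P V]) blast
  have nc: "(-c) \<bullet> e x = (-c) \<bullet> e y" "\<And>p. p \<in> ?P - {e x, e y} \<Longrightarrow> (-c) \<bullet> p \<noteq> (-c) \<bullet> e x"
    using c by simp_all
  obtain h1 where h1: "poly_height P h1" "initial ?P h1 (?P \<inter> F)" "\<forall>v\<in>?P - {e x}. h1 (e x) < h1 v"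
    "\<And>u. u \<in> ?P - {e x, e y} \<Longrightarrow> h1 u < h1 (e y) \<Longrightarrow> c \<bullet> u < c \<bullet> e x"
    by (rule poly_height_tilted[OF P F VF V(3) c]) blast+
  obtain h2 where h2: "poly_height P h2" "initial ?P h2 (?P \<inter> F)" "\<forall>v\<in>?P - {e x}. h2 (e x) < h2 v"
    "\<And>u. u \<in> ?P - {e x, e y} \<Longrightarrow> h2 u < h2 (e y) \<Longrightarrow> (-c) \<bullet> u < (-c) \<bullet> e x"
    by (rule poly_height_tilted[OF P F VF V(3) nc]) blast+
  have disj: "\<not> (h1 (e u) < h1 (e y) \<and> h2 (e u) < h2 (e y))" if u: "adj y u" for u
  proof
    assume l: "h1 (e u) < h1 (e y) \<and> h2 (e u) < h2 (e y)"
    have "poly_adj P (e y) (e u)" "u \<in> V" using u by (simp_all add: adj)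
    \<comment> \<open>Both heights put \<open>x\<close> below \<open>y\<close>; non-adjacency
      ensures that \<open>x\<close> is not among the neighbours compared.\<close>
    moreover have "u \<noteq> x" using u a poly_adj_sym by (auto simp: adj)
    ultimately have "e u \<in> ?P - {e x, e y}" using poly_adjD label_inj x(1) by auto
    then show False using h1(4)[of "e u"] h2(4)[of "e u"] l by simp
  qed
  have no_sink: "y \<notin> sinks adj (k \<circ> e) W"
    if k: "poly_height P k'" "\<forall>v\<in>?P - {e x}. k' (e x) < k' v" and W: "W \<in> labelled_faces e V P" "x \<in> W"
      and d: "\<And>u. adj y u \<Longrightarrow> \<not> (k (e u) < k (e y) \<and> k' (e u) < k' (e y))" for k k' W
  proof
    assume s: "y \<in> sinks adj (k \<circ> e) W"
    obtain G where G: "G face_of P" and WG: "W = {v \<in> V. e v \<in> G}" using W(1) by (auto simp: labelled_faces_def)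
    have xy: "e x \<in> G" "e y \<in> G" using s W(2) by (auto simp: sinks_def WG)
    obtain b where b: "\<forall>p\<in>?P. (k' p < k' (e y) \<longleftrightarrow> b \<bullet> p < b \<bullet> e y) \<and> (k' (e y) < k' p \<longleftrightarrow> b \<bullet> e y < b \<bullet> p)"
      using k(1) V(2) unfolding poly_height_def by blast
    \<comment> \<open>Negation turns the local minimum of \<open>k'\<close> at \<open>y\<close> into
      a local maximum, to which \<open>face_local_max\<close> applies.\<close>
    have "(-b) \<bullet> p \<le> (-b) \<bullet> e y" if p: "poly_adj P (e y) p" "p \<in> G" for p
    proof -
      obtain u where u: "u \<in> V" "e u = p" using poly_adjD[OF p(1)] by (auto elim: label_obtain)
      then have yu: "adj y u" "u \<in> W" using p y by (simp_all add: adj WG)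
      then have "k (e u) < k (e y)" using s by (simp add: sinks_def)
      then have "\<not> k' p < k' (e y)" using d[OF yu(1)] u(2) by simp
      moreover have "p \<in> ?P" using poly_adjD[OF p(1)] by simp
      ultimately have "\<not> b \<bullet> p < b \<bullet> e y" using b by blast
      then show ?thesis by simp
    qed
    then have "(-b) \<bullet> e x \<le> (-b) \<bullet> e y"
      using face_local_max[OF P G V(2) xy(2), of "-b" "e x"] xy(1) by blast
    then have "\<not> b \<bullet> e x < b \<bullet> e y" by simp
    then have "\<not> k' (e x) < k' (e y)" using b V(1) by blast
    then show False using k(2) V by auto
  qed
  have "y \<notin> sinks adj (h1 \<circ> e) W" if "W \<in> labelled_faces e V P" "x \<in> W" for W
    using no_sink[OF h2(1,3) that, of h1] disj by blast
  moreover have "y \<notin> sinks adj (h2 \<circ> e) W" if "W \<in> labelled_faces e V P" "x \<in> W" for W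
    using no_sink[OF h1(1,3) that, of h2] disj by blast
  ultimately show ?thesis
    using labelled_height[OF h1(1)] labelled_initial[OF h1(2)] labelled_ball[OF h1(3) x(1)]
      labelled_height[OF h2(1)] labelled_initial[OF h2(2)] labelled_ball[OF h2(3) x(1)] disj
    by (intro exI[of _ "h1 \<circ> e"] exI[of _ "h2 \<circ> e"]) simp
qed

lemma labelled_nbr_sub:
  assumes F: "F face_of P" "G face_of P" and v: "v \<in> V" "e v \<in> F" "e v \<in> G"
    and sub: "{v \<in> V. e v \<in> F} \<inter> Collect (adj v) \<subseteq> {v \<in> V. e v \<in> G}"
  shows "F \<subseteq> G"
proof (rule face_subset_nbrs[OF P F label_vertex[OF v(1)] v(2,3)])
  fix p assume p: "poly_adj P (e v) p" "p \<in> F"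
  obtain u where u: "u \<in> V" "e u = p" using poly_adjD[OF p(1)] by (auto elim: label_obtain)
  then have "u \<in> {v \<in> V. e v \<in> F} \<inter> Collect (adj v)" using p v by (simp add: adj)
  then show "p \<in> G" using sub u by auto
qed

lemma labelled_card_nbrs:
  assumes "v \<in> V"
  shows "card ({u \<in> V. e u \<in> F} \<inter> Collect (adj v)) = card {p \<in> F. poly_adj P (e v) p}"
proof -
  have "bij_betw e ({u \<in> V. e u \<in> F} \<inter> Collect (adj v)) {p \<in> F. poly_adj P (e v) p}"
  proof (rule bij_betw_imageI)
    show "inj_on e ({u \<in> V. e u \<in> F} \<inter> Collect (adj v))" using e by (auto simp: bij_betw_def inj_on_def)
    show "e ` ({u \<in> V. e u \<in> F} \<inter> Collect (adj v)) = {p \<in> F. poly_adj P (e v) p}"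
    proof
      show "e ` ({u \<in> V. e u \<in> F} \<inter> Collect (adj v)) \<subseteq> {p \<in> F. poly_adj P (e v) p}" by (auto simp: adj)
      show "{p \<in> F. poly_adj P (e v) p} \<subseteq> e ` ({u \<in> V. e u \<in> F} \<inter> Collect (adj v))"
      proof
        fix p assume p: "p \<in> {p \<in> F. poly_adj P (e v) p}"
        then obtain u where "u \<in> V" "e u = p" using poly_adjD[of P "e v" p] by (auto elim: label_obtain)
        then show "p \<in> e ` ({u \<in> V. e u \<in> F} \<inter> Collect (adj v))" using p assms by (auto simp: adj)
      qed
    qed
  qed
  then show ?thesis by (rule bij_betw_same_card)
qed

lemma labelled_span_face:
  assumes v: "v \<in> V" "int (poly_degree P (e v)) = aff_dim P" and S: "S \<subseteq> Collect (adj v)"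
  shows "\<exists>W\<in>labelled_faces e V P. v \<in> W \<and> W \<inter> Collect (adj v) = S"
proof -
  have "e ` S \<subseteq> {u. poly_adj P (e v) u}" using S by (auto simp: adj)
  then obtain F where F: "F face_of P" "e v \<in> F" "{u \<in> F. poly_adj P (e v) u} = e ` S"
    by (rule simple_face_spanned[OF P label_vertex[OF v(1)] v(2)])
  have "{u \<in> V. e u \<in> F} \<inter> Collect (adj v) = S"
  proof
    show "{u \<in> V. e u \<in> F} \<inter> Collect (adj v) \<subseteq> S"
    proof
      fix u assume u: "u \<in> {u \<in> V. e u \<in> F} \<inter> Collect (adj v)"
      then have "e u \<in> {u \<in> F. poly_adj P (e v) u}" by (simp add: adj)
      then obtain w where w: "w \<in> S" "e u = e w" unfolding F(3) by blast
      then have "w \<in> V" using S by (auto simp: adj)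
      then show "u \<in> S" using label_inj[of u w] w u by simp
    qed
    show "S \<subseteq> {u \<in> V. e u \<in> F} \<inter> Collect (adj v)"
    proof
      fix u assume u: "u \<in> S"
      then have "e u \<in> F" using F(3) by blast
      moreover have "adj v u" using u S by auto
      ultimately show "u \<in> {u \<in> V. e u \<in> F} \<inter> Collect (adj v)" by (simp add: adj)
    qed
  qed
  moreover have "F \<noteq> {}" using F(2) by blast
  then have "{u \<in> V. e u \<in> F} \<in> labelled_faces e V P" using F(1) unfolding labelled_faces_def by blast
  ultimately show ?thesis using v(1) F(2) by (intro bexI[of _ "{u \<in> V. e u \<in> F}"]) simp_all
qed

text \<open>Simplicity away from \<open>x\<close> and \<open>y\<close> enters through
  \<open>span_face\<close> and \<open>deg_face\<close>; the heights are those constructed above for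
  arbitrary polytopes.\<close>

lemma labelled_face_system:
  assumes xy: "x \<in> V" "y \<in> V" "x \<noteq> y"
    and simple: "\<And>v. v \<in> V - {x, y} \<Longrightarrow> int (poly_degree P (e v)) = aff_dim P"
  shows "face_system V adj x y (labelled_faces e V P)"
proof
  let ?F = "labelled_faces e V P"
  have PP: "P face_of P" "P \<noteq> {}"
    using face_of_refl[OF polytope_imp_convex[OF P]] label_vertex[OF xy(1)] poly_vertices_subset by auto
  have mem: "{v \<in> V. e v \<in> F} \<in> ?F" if "F face_of P" "F \<noteq> {}" for F
    using that unfolding labelled_faces_def by blast
  have dest: "\<exists>F. F face_of P \<and> F \<noteq> {} \<and> W = {v \<in> V. e v \<in> F}" if "W \<in> ?F" for W
    using that unfolding labelled_faces_def by blast
  show "finite V" using bij_betw_finite[OF e] finite_poly_vertices[OF P] by simp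
  show "u \<in> V \<and> v \<in> V \<and> u \<noteq> v" if "adj u v" for u v using that by (auto simp: adj)
  show "adj v u" if "adj u v" for u v using that poly_adj_sym by (auto simp: adj)
  show "x \<in> V" "y \<in> V" "x \<noteq> y" by (fact xy)+
  show "W \<noteq> {}" if W: "W \<in> ?F" for W
  proof -
    obtain F where F: "F face_of P" "F \<noteq> {}" "W = {v \<in> V. e v \<in> F}" using dest[OF W] by blast
    then have "convex hull (e ` W) = F" using labelled_face_hull[OF P e] by simp
    then show ?thesis using F(2) by auto
  qed
  show "W \<subseteq> V" if "W \<in> ?F" for W using that by (auto simp: labelled_faces_def)
  show "V \<in> ?F"
  proof -
    have "{v \<in> V. e v \<in> P} = V" using label_vertex poly_vertices_subset by auto
    then show ?thesis using mem[OF PP] by simp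
  qed
  show "{v} \<in> ?F" if v: "v \<in> V" for v
  proof -
    have "{w \<in> V. e w \<in> {e v}} = {v}" using v label_inj by auto
    moreover have "{e v} face_of P" using label_vertex[OF v] by (simp add: poly_vertices_def)
    ultimately show ?thesis using mem[of "{e v}"] by simp
  qed
  show "{u, v} \<in> ?F" if a: "adj u v" for u v
  proof -
    have uv: "u \<in> V" "v \<in> V" "poly_adj P (e u) (e v)" using a by (simp_all add: adj)
    note E = poly_adj_segment_face[OF P uv(3)]
    have "w \<in> {u, v}" if "w \<in> V" "e w \<in> closed_segment (e u) (e v)" for w
      using E(2) that label_vertex[of w] label_inj uv by blast
    then have "{w \<in> V. e w \<in> closed_segment (e u) (e v)} = {u, v}" using uv by auto
    then show ?thesis using mem[OF E(1)] by simp
  qed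
  show "W \<inter> U \<in> ?F" if W: "W \<in> ?F" and U: "U \<in> ?F" and ne: "W \<inter> U \<noteq> {}" for W U
  proof -
    obtain F where F: "F face_of P" "W = {v \<in> V. e v \<in> F}" using dest[OF W] by blast
    obtain G where G: "G face_of P" "U = {v \<in> V. e v \<in> G}" using dest[OF U] by blast
    have "W \<inter> U = {v \<in> V. e v \<in> F \<inter> G}" using F G by auto
    moreover from this have "F \<inter> G \<noteq> {}" using ne by auto
    ultimately show ?thesis using mem[OF face_of_Int[OF F(1) G(1)]] by simp
  qed
  show "W \<subseteq> U" if W: "W \<in> ?F" and U: "U \<in> ?F" and v: "v \<in> W" "v \<in> U" and sub: "W \<inter> Collect (adj v) \<subseteq> U" for W U v
  proof -
    obtain F where F: "F face_of P" "W = {v \<in> V. e v \<in> F}" using dest[OF W] by blast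
    obtain G where G: "G face_of P" "U = {v \<in> V. e v \<in> G}" using dest[OF U] by blast
    have "F \<subseteq> G" using labelled_nbr_sub[OF F(1) G(1), of v] v sub unfolding F(2) G(2) by blast
    then show ?thesis using F G by auto
  qed
  show "\<exists>W\<in>?F. v \<in> W \<and> W \<inter> Collect (adj v) = S" if "v \<in> V - {x, y}" "S \<subseteq> Collect (adj v)" for v S
    using labelled_span_face[OF _ simple[OF that(1)] that(2)] that(1) by simp
  show "card (W \<inter> Collect (adj v)) = card (W \<inter> Collect (adj w))"
    if W: "W \<in> ?F" and v: "v \<in> W - {x, y}" and w: "w \<in> W - {x, y}" for W v w
  proof -
    obtain F where F: "F face_of P" "W = {v \<in> V. e v \<in> F}" using dest[OF W] by blast
    have vw: "v \<in> V" "w \<in> V" "e v \<in> F" "e w \<in> F" using v w F(2) by auto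
    have "int (card (W \<inter> Collect (adj v))) = aff_dim F"
      using simple_face_aff_dim[OF P label_vertex[OF vw(1)] simple F(1) vw(3)] v vw labelled_card_nbrs[OF vw(1), of F] F(2) by simp
    moreover have "int (card (W \<inter> Collect (adj w))) = aff_dim F"
      using simple_face_aff_dim[OF P label_vertex[OF vw(2)] simple F(1) vw(4)] w vw labelled_card_nbrs[OF vw(2), of F] F(2) by simp
    ultimately show ?thesis by simp
  qed
  show "\<exists>h. height V adj ?F h \<and> initial V h W" if W: "W \<in> ?F" for W
  proof -
    obtain F where F: "F face_of P" "W = {v \<in> V. e v \<in> F}" using dest[OF W] by blast
    obtain h where "poly_height P h" "initial (poly_vertices P) h (poly_vertices P \<inter> F)"
      using poly_height_initial[OF P F(1)] .
    then show ?thesis using labelled_height labelled_initial F(2) by blast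
  qed
  show "\<exists>h. height V adj ?F h \<and> initial V h W \<and> (\<forall>v\<in>V - {s}. h s < h v) \<and> (\<forall>v\<in>V - {t}. h v < h t)"
    if W: "W \<in> ?F" and s: "s \<in> W" and t: "t \<in> V - W" for W s t
  proof -
    obtain F where F: "F face_of P" "W = {v \<in> V. e v \<in> F}" using dest[OF W] by blast
    show ?thesis using labelled_height_separating[OF F(1), of s t] s t unfolding F(2) by simp
  qed
  show "\<exists>h. height V adj ?F h \<and> initial V h W \<and> (\<forall>v\<in>V - {x}. h x < h v) \<and> (\<forall>v\<in>V. h v < h y \<longrightarrow> v = x)"
    if W: "W \<in> ?F" and x: "x \<in> W" and y: "y \<in> W" and a: "adj x y" for W
  proof -
    obtain F where F: "F face_of P" "W = {v \<in> V. e v \<in> F}" using dest[OF W] by blast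
    show ?thesis using labelled_height_adjacent[OF F(1) _ _ a] x y unfolding F(2) by simp
  qed
  show "\<exists>h1 h2. (\<forall>h\<in>{h1, h2}. height V adj ?F h \<and> initial V h W \<and> (\<forall>v\<in>V - {x}. h x < h v) \<and>
        (\<forall>G\<in>?F. x \<in> G \<longrightarrow> y \<notin> sinks adj h G)) \<and> (\<forall>u. adj y u \<longrightarrow> \<not> (h1 u < h1 y \<and> h2 u < h2 y))"
    if W: "W \<in> ?F" and x: "x \<in> W" and y: "y \<in> W" and a: "\<not> adj x y" for W
  proof -
    obtain F where F: "F face_of P" "W = {v \<in> V. e v \<in> F}" using dest[OF W] by blast
    have F': "e x \<in> F" "e y \<in> F" using x y F(2) by auto
    show ?thesis unfolding F(2) by (rule labelled_height_nonadjacent[OF F(1) xy(1) F'(1) xy(2) F'(2) xy(3) a])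
  qed
qed

end

section \<open>The dimension as an invariant of the graph\<close>

lemma poly_degree_iso:
  assumes f: "bij_betw f (poly_vertices P) (poly_vertices Q)"
    and fadj: "\<forall>u\<in>poly_vertices P. \<forall>v\<in>poly_vertices P. poly_adj P u v \<longleftrightarrow> poly_adj Q (f u) (f v)"
    and v: "v \<in> poly_vertices P"
  shows "poly_degree Q (f v) = poly_degree P v"
proof -
  have "bij_betw f {u. poly_adj P v u} {u. poly_adj Q (f v) u}"
  proof (rule bij_betw_imageI)
    show "inj_on f {u. poly_adj P v u}"
      using f by (auto simp: bij_betw_def intro: inj_on_subset dest: poly_adjD)
    show "f ` {u. poly_adj P v u} = {u. poly_adj Q (f v) u}"
    proof
      show "f ` {u. poly_adj P v u} \<subseteq> {u. poly_adj Q (f v) u}" using fadj v by (auto dest: poly_adjD)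
      show "{u. poly_adj Q (f v) u} \<subseteq> f ` {u. poly_adj P v u}"
      proof
        fix w assume w: "w \<in> {u. poly_adj Q (f v) u}"
        then have "w \<in> f ` poly_vertices P" using f poly_adjD[of Q "f v" w] by (simp add: bij_betw_def)
        then show "w \<in> f ` {u. poly_adj P v u}" using w fadj v by blast
      qed
    qed
  qed
  then show ?thesis unfolding poly_degree_def by (metis bij_betw_same_card)
qed

text \<open>Otherwise the two exceptional vertices would be all vertices and \<open>P\<close> a
  segment, whose ends have degree 1, which is its dimension.\<close>

lemma nearly_simple_simple_vertex:
  fixes P :: "'a::euclidean_space set"
  assumes "nearly_simple 2 P"
  shows "\<exists>v\<in>poly_vertices P. int (poly_degree P v) = aff_dim P"
proof (rule ccontr)
  assume "\<not> ?thesis"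
  then have n: "int (poly_degree P v) \<noteq> aff_dim P" if "v \<in> poly_vertices P" for v using that by blast
  have P: "polytope P" using assms by (simp add: nearly_simple_def)
  have "{v \<in> poly_vertices P. int (poly_degree P v) \<noteq> aff_dim P} = poly_vertices P" using n by auto
  then have "card (poly_vertices P) = 2" using assms by (simp add: nearly_simple_def)
  then obtain a b where ab: "poly_vertices P = {a, b}" "a \<noteq> b" by (auto simp: card_2_iff)
  have PE: "P = closed_segment a b" using polytope_hull_vertices[OF P] ab by (simp add: segment_convex_hull)
  have dim: "aff_dim P = 1" using ab(2) unfolding PE by (simp add: segment_convex_hull aff_dim_convex_hull)
  have "poly_degree P a \<le> card {b}"
    unfolding poly_degree_def using ab(1) by (intro card_mono) (auto dest!: poly_adjD)
  moreover have "aff_dim P \<le> int (poly_degree P a)" using aff_dim_le_poly_degree[OF P] ab by simp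
  ultimately show False using n[of a] ab(1) dim by simp
qed

text \<open>A simple vertex of \<open>P\<close> has the dimension of \<open>P\<close> as its degree,
  and the same degree at the corresponding vertex bounds the dimension of \<open>Q\<close>. Applied
  in both directions, this makes the dimensions equal.\<close>

lemma nearly_simple_aff_dim_le:
  fixes P :: "'a::euclidean_space set" and Q :: "'b::euclidean_space set"
  assumes "nearly_simple 2 P" "polytope Q"
    and f: "bij_betw f (poly_vertices P) (poly_vertices Q)"
    and fadj: "\<forall>u\<in>poly_vertices P. \<forall>v\<in>poly_vertices P. poly_adj P u v \<longleftrightarrow> poly_adj Q (f u) (f v)"
  shows "aff_dim Q \<le> aff_dim P"
proof -
  obtain v where v: "v \<in> poly_vertices P" "int (poly_degree P v) = aff_dim P"
    using nearly_simple_simple_vertex[OF assms(1)] by blast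
  have "f v \<in> poly_vertices Q" using f v(1) by (auto simp: bij_betw_def)
  then have "aff_dim Q \<le> int (poly_degree Q (f v))" by (rule aff_dim_le_poly_degree[OF assms(2)])
  then show ?thesis using poly_degree_iso[OF f fadj v(1)] v(2) by simp
qed

section \<open>From equal face systems to an isomorphism of face lattices\<close>

theorem theorem2p24:
  fixes P :: "'a::euclidean_space set" and Q :: "'b::euclidean_space set"
  assumes "nearly_simple 2 P" and "nearly_simple 2 Q" and "graph_iso P Q"
  shows "face_lattice_iso P Q"
proof -
  have P: "polytope P" and Q: "polytope Q" using assms(1,2) by (simp_all add: nearly_simple_def)
  let ?V = "poly_vertices P"
  obtain f where f: "bij_betw f ?V (poly_vertices Q)"
    and fadj: "\<forall>u\<in>?V. \<forall>v\<in>?V. poly_adj P u v \<longleftrightarrow> poly_adj Q (f u) (f v)"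
    using assms(3) by (auto simp: graph_iso_def)
  define g where "g = inv_into ?V f"
  have g: "bij_betw g (poly_vertices Q) ?V" unfolding g_def by (rule bij_betw_inv_into[OF f])
  have fg: "f (g w) = w" if "w \<in> poly_vertices Q" for w
    using that f unfolding g_def by (auto simp: bij_betw_def f_inv_into_f)
  have gadj: "\<forall>u\<in>poly_vertices Q. \<forall>v\<in>poly_vertices Q. poly_adj Q u v \<longleftrightarrow> poly_adj P (g u) (g v)"
    using fadj fg g by (metis bij_betwE)
  \<comment> \<open>Equal dimensions and equal degrees mean that \<open>f\<close> respects
    simplicity of vertices, so one pair \<open>x\<close>, \<open>y\<close> serves both
    polytopes.\<close>
  have dim: "aff_dim Q = aff_dim P"
    using nearly_simple_aff_dim_le[OF assms(1) Q f fadj] nearly_simple_aff_dim_le[OF assms(2) P g gadj] by simp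
  obtain x y where xy: "{v \<in> ?V. int (poly_degree P v) \<noteq> aff_dim P} = {x, y}" "x \<noteq> y"
    using assms(1) by (auto simp: nearly_simple_def card_2_iff)
  then have xyV: "x \<in> ?V" "y \<in> ?V" by auto
  have simpleP: "int (poly_degree P (id v)) = aff_dim P" if "v \<in> ?V - {x, y}" for v
    using xy(1) that by auto
  have simpleQ: "int (poly_degree Q (f v)) = aff_dim Q" if "v \<in> ?V - {x, y}" for v
    using simpleP[OF that] poly_degree_iso[OF f fadj, of v] that dim by simp
  have adjP: "poly_adj P u v \<longleftrightarrow> u \<in> ?V \<and> v \<in> ?V \<and> poly_adj P (id u) (id v)" for u v
    using poly_adjD[of P u v] by auto
  have adjQ: "poly_adj P u v \<longleftrightarrow> u \<in> ?V \<and> v \<in> ?V \<and> poly_adj Q (f u) (f v)" for u v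
    using poly_adjD[of P u v] fadj by auto
  have id: "bij_betw id ?V ?V" by simp
  \<comment> \<open>Both polytopes are labelled by the vertices of \<open>P\<close>, one through
    \<open>id\<close> and one through \<open>f\<close>, so that graph and exceptional vertices
    coincide.\<close>
  interpret two_face_systems ?V "poly_adj P" x y "labelled_faces id ?V P" "labelled_faces f ?V Q"
    by (intro two_face_systems.intro
        labelled_face_system[OF P id adjP xyV xy(2) simpleP] labelled_face_system[OF Q f adjQ xyV xy(2) simpleQ])
  have hullP: "convex hull {v \<in> ?V. v \<in> F} = F" if "F face_of P" for F
    using labelled_face_hull[OF P id that] by simp
  have hullQ: "convex hull (f ` {v \<in> ?V. f v \<in> G}) = G" if "G face_of Q" for G
    using labelled_face_hull[OF Q f that] .
  have PQ: "\<exists>G. G face_of Q \<and> {v \<in> ?V. v \<in> F} = {v \<in> ?V. f v \<in> G}" if F: "F face_of P" for F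
  \<comment> \<open>The empty face is not among the labelled faces and is matched with the empty
    face.\<close>
  proof (cases "F = {}")
    case False
    then have "{v \<in> ?V. v \<in> F} \<in> labelled_faces id ?V P" using F unfolding labelled_faces_def by auto
    then show ?thesis unfolding face_systems_eq by (auto simp: labelled_faces_def)
  qed (auto intro!: exI[of _ "{}"])
  have QP: "\<exists>F. F face_of P \<and> {v \<in> ?V. v \<in> F} = {v \<in> ?V. f v \<in> G}" if G: "G face_of Q" for G
  proof (cases "G = {}")
    case False
    then have "{v \<in> ?V. f v \<in> G} \<in> labelled_faces f ?V Q" using G unfolding labelled_faces_def by auto
    then show ?thesis unfolding face_systems_eq[symmetric] by (auto simp: labelled_faces_def)
  qed (auto intro!: exI[of _ "{}"])
  \<comment> \<open>A face is sent to the hull of the images of its vertices; by equality of the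
    face systems this is the face of \<open>Q\<close> with the same labels.\<close>
  define k where "k F = convex hull (f ` {v \<in> ?V. v \<in> F})" for F
  have k: "k F face_of Q" "{v \<in> ?V. f v \<in> k F} = {v \<in> ?V. v \<in> F}" if F: "F face_of P" for F
  proof -
    obtain G where G: "G face_of Q" "{v \<in> ?V. v \<in> F} = {v \<in> ?V. f v \<in> G}" using PQ[OF F] by blast
    then have "k F = G" using hullQ[OF G(1)] by (simp add: k_def)
    then show "k F face_of Q" "{v \<in> ?V. f v \<in> k F} = {v \<in> ?V. v \<in> F}" using G by simp_all
  qed
  have sub: "F1 \<subseteq> F2 \<longleftrightarrow> k F1 \<subseteq> k F2" if F: "F1 face_of P" "F2 face_of P" for F1 F2
  proof
    assume "F1 \<subseteq> F2"
    then show "k F1 \<subseteq> k F2" unfolding k_def by (intro hull_mono image_mono) auto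
  next
    assume "k F1 \<subseteq> k F2"
    then have "{v \<in> ?V. v \<in> F1} \<subseteq> {v \<in> ?V. v \<in> F2}" using k(2)[OF F(1)] k(2)[OF F(2)] by blast
    then have "convex hull {v \<in> ?V. v \<in> F1} \<subseteq> convex hull {v \<in> ?V. v \<in> F2}" by (rule hull_mono)
    then show "F1 \<subseteq> F2" using hullP F by simp
  qed
  have "bij_betw k {F. F face_of P} {G. G face_of Q}"
  proof (rule bij_betw_imageI)
    show "inj_on k {F. F face_of P}" using sub by (intro inj_onI) (simp, metis subset_antisym order_refl)
    show "k ` {F. F face_of P} = {G. G face_of Q}"
    proof
      show "{G. G face_of Q} \<subseteq> k ` {F. F face_of P}"
      proof
        fix G assume "G \<in> {G. G face_of Q}"
        then have G: "G face_of Q" by simp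
        obtain F where F: "F face_of P" "{v \<in> ?V. v \<in> F} = {v \<in> ?V. f v \<in> G}" using QP[OF G] by blast
        have "k F = G" unfolding k_def F(2) by (rule hullQ[OF G])
        then show "G \<in> k ` {F. F face_of P}" using F(1) by blast
      qed
    qed (use k(1) in auto)
  qed
  then show ?thesis using sub unfolding face_lattice_iso_def by blast
qed

end
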